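(* Let $G$ be a connected graph and let $B_1,\ldots,B_k$ be all the non-complete blocks of $G$, with respective orders (numbers of vertices) $n_1,\ldots,n_k$. Then $$\eta(G)\ge \sum_{i=1}^k (2n_i-6).$$
   Context: All graphs are finite and simple. A block of a graph is a maximal connected subgraph without a cut-vertex of its own; a block is either a $2$-connected subgraph (on at least $3$ vertices), a single edge, or an isolated vertex. For a connected graph $G=(V,E)$, $d(a,b)$ is the length of a shortest path between $a$ and $b$. The Wiener index is $W(G)=\sum_{\{a,b\}\subseteq V} d(a,b)$ (sum over unordered pairs of vertices). The Szeged index is $\mathrm{Sz}(G)=\sum_{ab\in E} n_{ab}(a)\cdot n_{ab}(b)$, where $n_{ab}(a)$ is the number of vertices strictly closer to $a$ than to $b$, and $n_{ab}(b)$ is the number of vertices strictly closer to $b$ than to $a$. Define $\eta(G)=\mathrm{Sz}(G)-W(G)$. *)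

theory Defs
  imports "Graph_Theory.Graph_Theory"
begin

text \<open>
  A finite simple graph is a \<^locale>\<open>graph\<close>: a finite, loop-free, symmetric digraph without
  parallel arcs. Each undirected edge is thus a pair of opposite arcs.
\<close>

definition graph_dist :: "('a, 'b) pre_digraph \<Rightarrow> 'a \<Rightarrow> 'a \<Rightarrow> nat" where
  "graph_dist G a b = (LEAST n. \<exists>p. pre_digraph.apath G a p b \<and> length p = n)"

text \<open>
  The value at an unordered pair of a function of two arguments. It is meaningful only if the
  function is symmetric at that pair, see \<open>on_pair_eq\<close>.
\<close>

definition on_pair :: "('a \<Rightarrow> 'a \<Rightarrow> 'c) \<Rightarrow> 'a set \<Rightarrow> 'c" where
  "on_pair f e = (THE r. \<forall>a b. e = {a, b} \<longrightarrow> r = f a b)"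

lemma on_pair_eq:
  assumes "f a b = f b a"
  shows "on_pair f {a, b} = f a b"
  unfolding on_pair_def
proof (rule the_equality)
  show "\<forall>a' b'. {a, b} = {a', b'} \<longrightarrow> f a b = f a' b'"
    using assms by (auto simp: doubleton_eq_iff)
qed blast

definition wiener_index :: "('a, 'b) pre_digraph \<Rightarrow> nat" where
  "wiener_index G = (\<Sum>e \<in> {{a, b} | a b. a \<in> verts G \<and> b \<in> verts G}. on_pair (graph_dist G) e)"

definition closer :: "('a, 'b) pre_digraph \<Rightarrow> 'a \<Rightarrow> 'a \<Rightarrow> nat" where
  "closer G a b = card {x \<in> verts G. graph_dist G x a < graph_dist G x b}"

definition szeged_index :: "('a, 'b) pre_digraph \<Rightarrow> nat" where
  "szeged_index G =
     (\<Sum>e \<in> {{a, b} | a b. a \<rightarrow>\<^bsub>G\<^esub> b}. on_pair (\<lambda>a b. closer G a b * closer G b a) e)"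

definition eta :: "('a, 'b) pre_digraph \<Rightarrow> int" where
  "eta G = int (szeged_index G) - int (wiener_index G)"

text \<open>
  Deleting a cut-vertex separates two other vertices of the same component. With this definition
  neither a single vertex nor an end of a single edge is a cut-vertex.
\<close>

definition cut_vertex :: "('a, 'b) pre_digraph \<Rightarrow> 'a \<Rightarrow> bool" where
  "cut_vertex G v \<longleftrightarrow> v \<in> verts G \<and>
     (\<exists>a \<in> verts G - {v}. \<exists>b \<in> verts G - {v}.
        a \<rightarrow>\<^sup>*\<^bsub>G\<^esub> b \<and> \<not> a \<rightarrow>\<^sup>*\<^bsub>pre_digraph.del_vert G v\<^esub> b)"

definition block :: "('a, 'b) pre_digraph \<Rightarrow> ('a, 'b) pre_digraph \<Rightarrow> bool" where
  "block G B \<longleftrightarrow>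
     pre_digraph.max_subgraph G (\<lambda>H. graph H \<and> Digraph_Component.connected H \<and> (\<nexists>v. cut_vertex H v)) B"

definition complete_graph :: "('a, 'b) pre_digraph \<Rightarrow> bool" where
  "complete_graph G \<longleftrightarrow> K\<^bsub>card (verts G)\<^esub> G"

lemma (in graph) apath_reverse:
  assumes "apath u p v"
  shows "\<exists>q. apath v q u \<and> length q = length p"
proof -
  have "\<exists>q. awalk v q u \<and> awalk_verts v q = rev (awalk_verts u p)" if "awalk u p v" for u
    using that
  proof (induction p arbitrary: u)
    case Nil
    then show ?case by (auto simp: awalk_Nil_iff intro!: exI[of _ "[]"])
  next
    case (Cons e p)
    then have e: "e \<in> arcs G" "tail G e = u" and p: "awalk (head G e) p v"
      by (auto simp: awalk_Cons_iff)
    from Cons.IH[OF p] obtain q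
      where q: "awalk v q (head G e)" "awalk_verts v q = rev (awalk_verts (head G e) p)"
      by blast
    obtain e' where e': "e' \<in> arcs G" "tail G e' = head G e" "head G e' = tail G e"
      using sym_arcs e(1) by (metis symmetric_conv)
    then have w: "awalk (head G e) [e'] u"
      using e by (auto simp: awalk_def)
    have "awalk v (q @ [e']) u"
      using q(1) w by (rule awalk_appendI)
    moreover from this have "awalk_verts v (q @ [e']) = awalk_verts v q @ [u]"
      using q(1) e e' by (simp add: awalk_verts_append awalk_def)
    ultimately show ?case
      using q(2) e(2) by (intro exI[of _ "q @ [e']"]) simp
  qed
  then obtain q where "awalk v q u" "awalk_verts v q = rev (awalk_verts u p)"
    using assms by (auto simp: apath_def)
  then show ?thesis
    using assms by (metis apath_def distinct_rev length_awalk_verts length_rev nat.inject)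
qed

lemma (in graph) graph_dist_commute: "graph_dist G a b = graph_dist G b a"
proof -
  have "(\<exists>p. apath a p b \<and> length p = n) \<longleftrightarrow> (\<exists>p. apath b p a \<and> length p = n)" for n
    using apath_reverse by metis
  then show ?thesis by (simp add: graph_dist_def)
qed

end

(*
  For vertices x, y call an edge ab good if one end is closer to x and the other end is closer to y.
  Then Sz(G) counts the pairs {x, y} with their good edges. The edges of a geodesic from x to y are
  good, so eta(G) is the sum of the excesses c(x, y) = #good edges - d(x, y) >= 0.

  For a 2-connected non-complete graph on n vertices, grow a set S of vertices that has no cut-vertex
  of its own and satisfies sum_{x, y in S} c(x, y) >= 2 (2 |S| - 6), starting from two vertices at
  distance 2 and all their common neighbours, or from a cycle through an edge of a maximal clique if
  no two nonadjacent vertices have two common neighbours. S grows by a shortest ear e 0, ..., e L: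
  the vertices added gain two units each on average. The reason is that a walk from a vertex whose
  geodesic to x starts with one edge to a vertex whose geodesic starts with another must switch at
  some point, and there a second geodesic to x or an edge between vertices equidistant from x
  produces excess.

  A block is an isometric subgraph, and two blocks share at most one vertex, so their
  contributions add up.
*)

theory Submission
  imports Defs
begin

subsection \<open>Excess of a pair of vertices\<close>

text \<open>All excesses refer to the distances of the whole set \<open>V\<close>, also for pairs
  inside a growing set \<open>S\<close>, which need not be isometric; enlarging \<open>S\<close>
  therefore never changes what has been counted. The metric is abstract because it is used twice:
  for a connected graph, and for a block that carries the distances of the whole graph.
  \<open>total\<close> counts ordered pairs, whence the bound \<open>4 * card S - 12\<close>, and an
  ear of length \<open>L\<close> has to bring \<open>4 * (L - 1)\<close>. Two kinds of ears resist.
  A single new vertex (\<open>L = 2\<close>) may bring nothing if it is adjacent to all of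
  \<open>S\<close>. For this reason \<open>S\<close> always contains two vertices at distance 2 with
  all their common neighbours: such a vertex would already belong to \<open>S\<close>. An ear that
  closes a pentagon over an edge (\<open>L = 4\<close>) is only sure to bring 10 instead of 12; the
  difference comes from a third vertex of \<open>S\<close>.\<close>

locale graph_metric =
  fixes V :: "'a set" and d :: "'a \<Rightarrow> 'a \<Rightarrow> nat"
  assumes finite_V: "finite V"
    and dist_eq_0: "\<lbrakk>a \<in> V; b \<in> V\<rbrakk> \<Longrightarrow> d a b = 0 \<longleftrightarrow> a = b"
    and dist_sym: "\<lbrakk>a \<in> V; b \<in> V\<rbrakk> \<Longrightarrow> d a b = d b a"
    and dist_triangle: "\<lbrakk>a \<in> V; b \<in> V; c \<in> V\<rbrakk> \<Longrightarrow> d a c \<le> d a b + d b c"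
    and dist_step: "\<lbrakk>a \<in> V; b \<in> V; a \<noteq> b\<rbrakk> \<Longrightarrow> \<exists>c\<in>V. d a c = 1 \<and> d a b = Suc (d c b)"
begin

lemma dist_step_back:
  assumes "a \<in> V" "b \<in> V" "a \<noteq> b"
  shows "\<exists>c\<in>V. d c b = 1 \<and> d a b = Suc (d a c)"
  using dist_step[of b a] dist_sym assms by metis

lemma dist_self [simp]: "a \<in> V \<Longrightarrow> d a a = 0"
  using dist_eq_0 by blast

text \<open>An edge that is good for \<open>x\<close> and \<open>y\<close> is recorded as the pair directed from \<open>x\<close> to \<open>y\<close>.\<close>

definition good :: "'a \<Rightarrow> 'a \<Rightarrow> ('a \<times> 'a) set" where
  "good x y = {(a, b). a \<in> V \<and> b \<in> V \<and> d a b = 1 \<and> d x a < d x b \<and> d y b < d y a}"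

definition geodesic_arcs :: "'a \<Rightarrow> 'a \<Rightarrow> ('a \<times> 'a) set" where
  "geodesic_arcs x y = {(a, b). a \<in> V \<and> b \<in> V \<and> d a b = 1 \<and> d x a + 1 + d b y = d x y}"

definition excess :: "'a \<Rightarrow> 'a \<Rightarrow> int" where
  "excess x y = int (card (good x y)) - int (d x y)"

lemma finite_good [simp]: "finite (good x y)"
  by (rule finite_subset[of _ "V \<times> V"]) (auto simp: good_def finite_V)

lemma finite_geodesic_arcs [simp]: "finite (geodesic_arcs x y)"
  by (rule finite_subset[of _ "V \<times> V"]) (auto simp: geodesic_arcs_def finite_V)

lemma geodesic_arcs_subset_good:
  assumes "x \<in> V" "y \<in> V"
  shows "geodesic_arcs x y \<subseteq> good x y"
proof clarify
  fix a b assume "(a, b) \<in> geodesic_arcs x y"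
  then have *: "a \<in> V" "b \<in> V" "d a b = 1" "d x a + 1 + d b y = d x y"
    by (auto simp: geodesic_arcs_def)
  have "d x y \<le> d x b + d b y" "d x y \<le> d x a + d a y"
    using dist_triangle assms * by blast+
  then show "(a, b) \<in> good x y"
    using * dist_sym[of y a] dist_sym[of y b] assms by (auto simp: good_def)
qed

lemma geodesic_arcs_extend:
  assumes "x \<in> V" "y \<in> V" "z \<in> V" "d z y = 1" "d x y = Suc (d x z)"
  shows "insert (z, y) (geodesic_arcs x z) \<subseteq> geodesic_arcs x y" "(z, y) \<notin> geodesic_arcs x z"
proof -
  have "(a, b) \<in> geodesic_arcs x y" if "(a, b) \<in> geodesic_arcs x z" for a b
  proof -
    have *: "a \<in> V" "b \<in> V" "d a b = 1" "d x a + 1 + d b z = d x z"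
      using that by (auto simp: geodesic_arcs_def)
    have "d b y \<le> d b z + d z y" "d x y \<le> d x b + d b y" "d x b \<le> d x a + d a b"
      using dist_triangle assms * by blast+
    then show ?thesis
      using * assms by (auto simp: geodesic_arcs_def)
  qed
  moreover have "(z, y) \<in> geodesic_arcs x y"
    using assms by (auto simp: geodesic_arcs_def)
  ultimately show "insert (z, y) (geodesic_arcs x z) \<subseteq> geodesic_arcs x y" by auto
  show "(z, y) \<notin> geodesic_arcs x z"
    by (auto simp: geodesic_arcs_def)
qed

lemma card_geodesic_arcs:
  assumes "x \<in> V" "y \<in> V"
  shows "d x y \<le> card (geodesic_arcs x y)"
  using assms
proof (induction "d x y" arbitrary: y)
  case (Suc n)
  then have "x \<noteq> y" by auto
  then obtain z where z: "z \<in> V" "d z y = 1" "d x y = Suc (d x z)"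
    using dist_step_back Suc.prems by blast
  have "d x y \<le> Suc (card (geodesic_arcs x z))"
    using Suc z by simp
  also have "\<dots> = card (insert (z, y) (geodesic_arcs x z))"
    using geodesic_arcs_extend(2)[of x y z] Suc.prems z by simp
  also have "\<dots> \<le> card (geodesic_arcs x y)"
    using geodesic_arcs_extend(1)[of x y z] Suc.prems z by (intro card_mono) auto
  finally show ?case .
qed simp

text \<open>At least \<open>d x y\<close> good edges lie on geodesics. Good edges whose tail lies on
  no geodesic from \<open>x\<close> to \<open>y\<close> come on top of them.\<close>

lemma card_le_excess:
  assumes "x \<in> V" "y \<in> V" "X \<subseteq> good x y"
    and off: "\<And>a b. (a, b) \<in> X \<Longrightarrow> d x y < d x a + d a y"
  shows "int (card X) \<le> excess x y"
proof -
  have "X \<inter> geodesic_arcs x y = {}"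
  proof -
    have False if "(a, b) \<in> X" "(a, b) \<in> geodesic_arcs x y" for a b
    proof -
      have *: "a \<in> V" "b \<in> V" "d a b = 1" "d x a + 1 + d b y = d x y"
        using that by (auto simp: geodesic_arcs_def)
      have "d a y \<le> d a b + d b y" using * assms dist_triangle by blast
      then show False using off[OF that(1)] * by simp
    qed
    then show ?thesis by auto
  qed
  moreover have "finite X" using assms(3) finite_good finite_subset by blast
  ultimately have "card X + card (geodesic_arcs x y) = card (X \<union> geodesic_arcs x y)"
    by (simp add: card_Un_disjoint)
  also have "\<dots> \<le> card (good x y)"
    using assms geodesic_arcs_subset_good by (intro card_mono) auto
  finally show ?thesis
    using card_geodesic_arcs[OF assms(1,2)] by (simp add: excess_def)
qed

lemma excess_nonneg: "\<lbrakk>x \<in> V; y \<in> V\<rbrakk> \<Longrightarrow> 0 \<le> excess x y"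
  using card_le_excess[of x y "{}"] by simp

lemma one_le_excess:
  assumes "x \<in> V" "y \<in> V" "a \<in> V" "b \<in> V" "d a b = 1" "d x a < d x b" "d y b < d y a"
    "d x y < d x a + d a y"
  shows "1 \<le> excess x y"
  using card_le_excess[of x y "{(a, b)}"] assms by (auto simp: good_def)

lemma two_le_excess:
  assumes "x \<in> V" "y \<in> V"
    "a \<in> V" "b \<in> V" "d a b = 1" "d x a < d x b" "d y b < d y a" "d x y < d x a + d a y"
    "a' \<in> V" "b' \<in> V" "d a' b' = 1" "d x a' < d x b'" "d y b' < d y a'" "d x y < d x a' + d a' y"
    "(a, b) \<noteq> (a', b')"
  shows "2 \<le> excess x y"
proof -
  have "int (card {(a, b), (a', b')}) \<le> excess x y"
    using assms by (intro card_le_excess) (auto simp: good_def)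
  moreover have "card {(a, b), (a', b')} = 2" using assms(15) by (simp only: card_2_iff) blast
  ultimately show ?thesis by simp
qed

lemma excess_sym: "\<lbrakk>x \<in> V; y \<in> V\<rbrakk> \<Longrightarrow> excess x y = excess y x"
proof -
  assume xy: "x \<in> V" "y \<in> V"
  have "good y x = prod.swap ` good x y"
    using dist_sym by (auto simp: good_def image_iff)
  then have "card (good y x) = card (good x y)"
    by (simp add: card_image)
  then show ?thesis using dist_sym xy by (simp add: excess_def)
qed

lemma excess_self: "x \<in> V \<Longrightarrow> excess x x = 0"
proof -
  assume "x \<in> V"
  moreover have "good x x = {}" by (auto simp: good_def)
  ultimately show ?thesis by (simp add: excess_def)
qed

text \<open>Induction on the last step. If some predecessor of \<open>y\<close> is itself reached
  through both \<open>q\<close> and \<open>q'\<close>, its last arc is added to those before.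
  Otherwise a predecessor \<open>z\<close> reached through \<open>q\<close> is not reached through
  \<open>q'\<close>; then \<open>(z, y)\<close> and the first and last arcs \<open>(x, q')\<close>,
  \<open>(z', y)\<close> of a geodesic through \<open>q'\<close> are three arcs beyond the at least
  \<open>d x y - 1\<close> arcs between \<open>x\<close> and \<open>z\<close>.\<close>

lemma card_geodesic_arcs_two:
  assumes "x \<in> V" "y \<in> V" "q \<in> V" "q' \<in> V" "q \<noteq> q'" "d x q = 1" "d x q' = 1"
    "d x y = Suc (d q y)" "d x y = Suc (d q' y)"
  shows "d x y + 2 \<le> card (geodesic_arcs x y)"
  using assms
proof (induction "d x y" arbitrary: y)
  case (Suc n)
  show ?case
  proof (cases "\<exists>z\<in>V. d z y = 1 \<and> d x y = Suc (d x z) \<and> d x z = Suc (d q z) \<and> d x z = Suc (d q' z)")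
    case True
    then obtain z where z: "z \<in> V" "d z y = 1" "d x y = Suc (d x z)"
      "d x z = Suc (d q z)" "d x z = Suc (d q' z)" by blast
    have "d x z + 2 \<le> card (geodesic_arcs x z)"
      using Suc.hyps(2) Suc.prems z by (intro Suc.hyps(1)) auto
    then have "d x y + 2 \<le> Suc (card (geodesic_arcs x z))"
      using z by simp
    also have "\<dots> = card (insert (z, y) (geodesic_arcs x z))"
      using geodesic_arcs_extend(2)[of x y z] Suc.prems z by simp
    also have "\<dots> \<le> card (geodesic_arcs x y)"
      using geodesic_arcs_extend(1)[of x y z] Suc.prems z by (intro card_mono) auto
    finally show ?thesis .
  next
    case False
    have ne: "q \<noteq> y" "q' \<noteq> y" 
      using Suc.prems dist_eq_0 by (metis One_nat_def dist_self nat.inject)+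
    obtain z where z: "z \<in> V" "d z y = 1" "d q y = Suc (d q z)"
      using dist_step_back Suc.prems ne by meson
    obtain z' where z': "z' \<in> V" "d z' y = 1" "d q' y = Suc (d q' z')"
      using dist_step_back Suc.prems ne by meson
    have t: "d x z \<le> d x q + d q z" "d x y \<le> d x z + d z y"
      "d x z' \<le> d x q' + d q' z'" "d x y \<le> d x z' + d z' y"
      using dist_triangle Suc.prems z z' by blast+
    have xz: "d x y = Suc (d x z)" "d x z = Suc (d q z)"
      and xz': "d x y = Suc (d x z')" "d x z' = Suc (d q' z')"
      using t Suc.prems z z' by auto
    have nz: "d x z \<noteq> Suc (d q' z)" using False z xz by blast
    have "z \<noteq> z'" using nz xz' by blast
    have n1: "(x, q') \<notin> geodesic_arcs x z"
      using nz Suc.prems by (auto simp: geodesic_arcs_def)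
    have n2: "(z', y) \<notin> geodesic_arcs x z"
      using xz xz' by (auto simp: geodesic_arcs_def)
    have "(x, q') \<in> geodesic_arcs x y" "(z', y) \<in> geodesic_arcs x y"
      using Suc.prems xz' z' by (auto simp: geodesic_arcs_def)
    moreover have "(x, q') \<noteq> (z', y)" "(x, q') \<noteq> (z, y)" using ne by auto
    ultimately have "insert (x, q') (insert (z', y) (insert (z, y) (geodesic_arcs x z))) \<subseteq> geodesic_arcs x y"
      using geodesic_arcs_extend(1)[of x y z] Suc.prems z xz by auto
    then have "card (insert (x, q') (insert (z', y) (insert (z, y) (geodesic_arcs x z)))) \<le> card (geodesic_arcs x y)"
      by (intro card_mono) auto
    moreover have "card (insert (x, q') (insert (z', y) (insert (z, y) (geodesic_arcs x z)))) = 3 + card (geodesic_arcs x z)"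
      using n1 n2 geodesic_arcs_extend(2)[of x y z] Suc.prems z xz \<open>z \<noteq> z'\<close> ne by auto
    ultimately show ?thesis
      using card_geodesic_arcs[of x z] Suc.prems z xz by linarith
  qed
qed simp

lemma two_geodesics:
  assumes "x \<in> V" "y \<in> V" "q \<in> V" "q' \<in> V" "q \<noteq> q'" "d x q = 1" "d x q' = 1"
    "d x y = Suc (d q y)" "d x y = Suc (d q' y)"
  shows "2 \<le> excess x y"
proof -
  have "card (geodesic_arcs x y) \<le> card (good x y)"
    using assms geodesic_arcs_subset_good by (intro card_mono) auto
  then show ?thesis
    using card_geodesic_arcs_two[OF assms] by (simp add: excess_def)
qed

text \<open>The last edge \<open>w u\<close> of a geodesic from \<open>x\<close> through
  \<open>q\<close> to \<open>u\<close> is good for \<open>x\<close> and \<open>u'\<close>. It is off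
  every geodesic to \<open>u'\<close> because \<open>w\<close> is not adjacent to \<open>u'\<close>;
  otherwise the geodesic could be redirected to \<open>u'\<close>, which is not reached through
  \<open>q\<close>.\<close>

lemma horizontal_excess:
  assumes "x \<in> V" "u \<in> V" "u' \<in> V" "q \<in> V" "d u u' = 1" "d x u = d x u'" "2 \<le> d x u" "d x q = 1"
    "d x u = Suc (d q u)" "d x u' \<noteq> Suc (d q u')"
  shows "1 \<le> excess x u'"
proof -
  have "q \<noteq> u" using assms by auto
  then obtain w where w: "w \<in> V" "d w u = 1" "d q u = Suc (d q w)"
    using dist_step_back assms by meson
  have t: "d x u \<le> d x w + d w u" "d x w \<le> d x q + d q w" "d q u' \<le> d q w + d w u'"
    "d x u' \<le> d x q + d q u'" "d u' u \<le> d u' w + d w u" "d x w \<le> d x u' + d u' w"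
    "d x u' \<le> d x w + d w u'"
    using dist_triangle assms w by blast+
  have "d w u' \<noteq> 0" "d w u' \<noteq> 1"
    using t assms w dist_eq_0 by auto
  then have "1 < d w u'" by linarith
  then show ?thesis
    using t assms w dist_sym[of u' w] dist_sym[of u' u]
    by (intro one_le_excess[of x u' w u]) auto
qed

section \<open>Switching of geodesics along a walk, and sums of excesses\<close>

definition adj :: "'a set \<Rightarrow> ('a \<times> 'a) set" where
  "adj X = {(a, b). a \<in> X \<and> b \<in> X \<and> d a b = 1}"

text \<open>Along a walk from \<open>a\<close> to \<open>b\<close> the first edges of the geodesics from \<open>x\<close> have to switch away from
  \<open>q\<close>. This happens at a vertex with two geodesics or along an edge between two vertices
  equidistant from \<open>x\<close>.\<close>

lemma two_le_sum_excess:
  assumes X: "X \<subseteq> V" "x \<in> V" "x \<notin> X" and q: "q \<in> V" "q' \<in> V" "q \<noteq> q'" "d x q = 1" "d x q' = 1"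
    and ab: "(a, b) \<in> (adj X)\<^sup>*" "a \<in> X" "b \<in> X" "d x a = Suc (d q a)" "d x b = Suc (d q' b)"
    and no_tri: "\<And>u u'. \<lbrakk>u \<in> X; u' \<in> X; d u u' = 1; d x u = 1\<rbrakk> \<Longrightarrow> d x u' \<noteq> 1"
  shows "2 \<le> (\<Sum>y\<in>X. excess x y)"
proof -
  have fin: "finite X" using X(1) finite_V finite_subset by blast
  have nn: "\<And>y. y \<in> X \<Longrightarrow> 0 \<le> excess x y" using excess_nonneg X by blast
  show ?thesis
  proof (cases "\<exists>y\<in>X. \<exists>p\<in>V. p \<noteq> q \<and> d x p = 1 \<and> d x y = Suc (d q y) \<and> d x y = Suc (d p y)")
    case True
    then obtain y where "y \<in> X" "2 \<le> excess x y" using two_geodesics X q by blast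
    then show ?thesis using member_le_sum[of y X "excess x"] fin nn by fastforce
  next
    case False
    have "d x b \<noteq> Suc (d q b)" using False q ab by metis
    \<comment> \<open>If having a geodesic from \<open>x\<close> through \<open>q\<close> passed on
      to neighbours in \<open>X\<close>, it would pass from \<open>a\<close> to
      \<open>b\<close>.\<close>
    moreover have "d x b = Suc (d q b)" if "\<And>u u'. \<lbrakk>(u, u') \<in> adj X; d x u = Suc (d q u)\<rbrakk> \<Longrightarrow> d x u' = Suc (d q u')"
      using ab(1) by (induction rule: rtrancl_induct) (use ab that in auto)
    ultimately obtain u u' where u: "(u, u') \<in> adj X" "d x u = Suc (d q u)" "d x u' \<noteq> Suc (d q u')"
      by blast
    then have uu: "u \<in> X" "u' \<in> X" "u \<in> V" "u' \<in> V" "d u u' = 1"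
      using X by (auto simp: adj_def)
    then have uu': "d u' u = 1" using dist_sym by metis
    have "u' \<noteq> x" using uu X by blast
    then obtain p where p: "p \<in> V" "d x p = 1" "d x u' = Suc (d p u')"
      using dist_step[of x u'] X uu by metis
    then have "p \<noteq> q" using u by blast
    then have np: "d x u \<noteq> Suc (d p u)" using False uu p u by blast
    have t: "d x u' \<le> d x q + d q u'" "d q u' \<le> d q u + d u u'" "d x u \<le> d x p + d p u"
      "d p u \<le> d p u' + d u' u" "d x u \<le> d x u' + d u' u" "d x u' \<le> d x u + d u u'"
      using dist_triangle X uu p q by blast+
    \<comment> \<open>With different distances, a geodesic to the nearer vertex would extend to the
      farther one and give it the same first edge.\<close>
    have eq: "d x u = d x u'" using t u p uu uu' np q by linarith
    \<comment> \<open>At distance 1 the edge closes a triangle with \<open>x\<close> and need not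
      give any excess.\<close>
    have "2 \<le> d x u" using no_tri[of u u'] eq u uu by force
    then have "1 \<le> excess x u" "1 \<le> excess x u'"
      using horizontal_excess[of x u u' q] horizontal_excess[of x u' u p] eq p np u uu uu' X q by auto
    then have "2 \<le> excess x u + excess x u'" by simp
    also have "\<dots> = (\<Sum>y\<in>{u, u'}. excess x y)"
      using uu dist_eq_0[of u u'] by (subst sum.insert) auto
    also have "\<dots> \<le> (\<Sum>y\<in>X. excess x y)"
      using uu fin nn by (intro sum_mono2) auto
    finally show ?thesis .
  qed
qed

text \<open>Every unordered pair counts twice in \<open>total\<close>.\<close>

definition total :: "'a set \<Rightarrow> int" where
  "total S = (\<Sum>x\<in>S. \<Sum>y\<in>S. excess x y)"

lemma finite_in_V: "S \<subseteq> V \<Longrightarrow> finite S"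
  using finite_V by (rule rev_finite_subset)

lemma sum_excess_mono:
  assumes "x \<in> V" "A \<subseteq> B" "B \<subseteq> V"
  shows "(\<Sum>y\<in>A. excess x y) \<le> (\<Sum>y\<in>B. excess x y)"
proof (rule sum_mono2)
  show "finite B" using assms(3) by (rule finite_in_V)
  show "0 \<le> excess x b" if "b \<in> B - A" for b
    using that assms by (intro excess_nonneg) auto
qed (rule assms(2))

lemma total_insert:
  assumes "insert x S \<subseteq> V" "x \<notin> S"
  shows "total (insert x S) = total S + 2 * (\<Sum>y\<in>S. excess x y)"
proof -
  have fin: "finite S" using assms(1) finite_in_V by simp
  have "(\<Sum>y\<in>S. excess y x) = (\<Sum>y\<in>S. excess x y)"
    using assms(1) by (intro sum.cong refl excess_sym) auto
  moreover have "excess x x = 0" using assms(1) excess_self by simp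
  moreover have "(\<Sum>z\<in>insert x S. excess y z) = excess y x + (\<Sum>z\<in>S. excess y z)" for y
    using fin assms(2) by (rule sum.insert)
  moreover have "total (insert x S) = (\<Sum>z\<in>insert x S. excess x z) + (\<Sum>y\<in>S. \<Sum>z\<in>insert x S. excess y z)"
    unfolding total_def using fin assms(2) by (rule sum.insert)
  ultimately show ?thesis
    by (simp add: total_def sum.distrib)
qed

lemma total_mono:
  assumes "A \<subseteq> B" "B \<subseteq> V"
  shows "total A \<le> total B"
proof -
  have "total A \<le> (\<Sum>x\<in>A. \<Sum>y\<in>B. excess x y)"
    unfolding total_def using assms by (intro sum_mono sum_excess_mono) auto
  also have "\<dots> \<le> total B"
    unfolding total_def
  proof (rule sum_mono2)
    show "finite B" using assms(2) by (rule finite_in_V)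
    show "0 \<le> (\<Sum>y\<in>B. excess x y)" if "x \<in> B - A" for x
      using that assms by (intro sum_nonneg excess_nonneg) auto
  qed (rule assms(1))
  finally show ?thesis .
qed

text \<open>The order in which the vertices of \<open>T\<close> are added may depend on the set
  reached so far. Each of them brings 2, counted for both orders of a pair.\<close>

lemma total_extend:
  assumes "S \<union> T \<subseteq> V" "S \<inter> T = {}"
    and ext: "\<And>M. \<lbrakk>S \<subseteq> M; M \<subset> S \<union> T\<rbrakk> \<Longrightarrow> \<exists>x\<in>S \<union> T - M. 2 \<le> (\<Sum>y\<in>M. excess x y)"
  shows "total S + 4 * int (card T) \<le> total (S \<union> T)"
proof -
  have fin: "finite S" "finite T" using assms(1) finite_in_V by auto
  have "total M + 4 * int (card (S \<union> T - M)) \<le> total (S \<union> T)" if "S \<subseteq> M" "M \<subseteq> S \<union> T" for M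
    using that
  proof (induction "card (S \<union> T - M)" arbitrary: M)
    case 0
    then have "S \<union> T - M = {}" using fin by simp
    then have "M = S \<union> T" using 0 by blast
    then show ?case by simp
  next
    case (Suc n)
    then have "M \<noteq> S \<union> T" by auto
    then obtain x where x: "x \<in> S \<union> T - M" "2 \<le> (\<Sum>y\<in>M. excess x y)"
      using ext[of M] Suc.prems by blast
    have "S \<union> T - insert x M = (S \<union> T - M) - {x}" by blast
    then have n: "card (S \<union> T - insert x M) = n"
      using Suc.hyps(2) x by simp
    then have "total (insert x M) + 4 * int n \<le> total (S \<union> T)"
      using Suc.hyps(1)[of "insert x M"] Suc.prems x by auto
    moreover have "total (insert x M) = total M + 2 * (\<Sum>y\<in>M. excess x y)"
      using x Suc.prems assms by (intro total_insert) auto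
    ultimately show ?case using x Suc.hyps(2) by simp
  qed
  from this[of S] have "total S + 4 * int (card (S \<union> T - S)) \<le> total (S \<union> T)" by blast
  moreover have "S \<union> T - S = T" using assms by blast
  ultimately show ?thesis by simp
qed

subsection \<open>Sets without cut-vertices\<close>

definition conn :: "'a set \<Rightarrow> bool" where
  "conn X \<longleftrightarrow> (\<forall>a\<in>X. \<forall>b\<in>X. (a, b) \<in> (adj X)\<^sup>*)"

text \<open>Single vertices and the two ends of an edge qualify, in line with the convention for
  blocks.\<close>

definition nonsep :: "'a set \<Rightarrow> bool" where
  "nonsep X \<longleftrightarrow> conn X \<and> (\<forall>w\<in>X. conn (X - {w}))"

lemma adj_mono: "X \<subseteq> Y \<Longrightarrow> adj X \<subseteq> adj Y"
  by (auto simp: adj_def)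

lemma rtrancl_adj_mono: "\<lbrakk>(a, b) \<in> (adj X)\<^sup>*; X \<subseteq> Y\<rbrakk> \<Longrightarrow> (a, b) \<in> (adj Y)\<^sup>*"
  using rtrancl_mono[OF adj_mono[of X Y]] by blast

lemma sym_adj: "X \<subseteq> V \<Longrightarrow> sym (adj X)"
  using dist_sym by (fastforce simp: adj_def intro!: symI)

lemma relpow_adj_sym: "\<lbrakk>X \<subseteq> V; (a, b) \<in> adj X ^^ n\<rbrakk> \<Longrightarrow> (b, a) \<in> adj X ^^ n"
proof (induction n arbitrary: b)
  case (Suc n)
  then obtain c where "(a, c) \<in> adj X ^^ n" "(c, b) \<in> adj X" by auto
  then show ?case
    using Suc.IH[OF Suc.prems(1)] symD[OF sym_adj[OF Suc.prems(1)]] by (blast intro: relpow_Suc_I2)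
qed auto

lemma rtrancl_adj_sym: "\<lbrakk>X \<subseteq> V; (a, b) \<in> (adj X)\<^sup>*\<rbrakk> \<Longrightarrow> (b, a) \<in> (adj X)\<^sup>*"
  using symD[OF sym_rtrancl[OF sym_adj[of X]]] by blast

lemma rtrancl_adj_in: "\<lbrakk>(a, b) \<in> (adj X)\<^sup>*; a \<in> X\<rbrakk> \<Longrightarrow> b \<in> X"
  by (induction rule: rtrancl_induct) (auto simp: adj_def)

lemma relpow_adj_in: "\<lbrakk>(a, b) \<in> adj X ^^ n; a \<in> X\<rbrakk> \<Longrightarrow> b \<in> X"
  using rtrancl_adj_in relpow_imp_rtrancl by metis

lemma conn_V: "conn V"
proof -
  have "(a, b) \<in> (adj V)\<^sup>*" if "a \<in> V" "b \<in> V" for a b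
    using that
  proof (induction "d a b" arbitrary: a)
    case 0
    then show ?case using dist_eq_0 by simp
  next
    case (Suc n)
    then obtain c where c: "c \<in> V" "d a c = 1" "d a b = Suc (d c b)"
      using dist_step[of a b] by fastforce
    then have "(a, c) \<in> adj V" "(c, b) \<in> (adj V)\<^sup>*" using Suc by (auto simp: adj_def)
    then show ?case by (rule converse_rtrancl_into_rtrancl)
  qed
  then show ?thesis by (auto simp: conn_def)
qed

lemma connI_anchor:
  assumes "X \<subseteq> Y" "Y \<subseteq> V" "conn X" and "\<And>y. y \<in> Y \<Longrightarrow> \<exists>x\<in>X. (y, x) \<in> (adj Y)\<^sup>*"
  shows "conn Y"
  unfolding conn_def
proof (intro ballI)
  fix a b assume "a \<in> Y" "b \<in> Y"
  then obtain x y where "x \<in> X" "y \<in> X" "(a, x) \<in> (adj Y)\<^sup>*" "(b, y) \<in> (adj Y)\<^sup>*"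
    using assms(4) by meson
  moreover from this have "(x, y) \<in> (adj Y)\<^sup>*" 
    using assms rtrancl_adj_mono unfolding conn_def by blast
  moreover have "(y, b) \<in> (adj Y)\<^sup>*" using calculation assms rtrancl_adj_sym by blast
  ultimately show "(a, b) \<in> (adj Y)\<^sup>*" by (meson rtrancl_trans)
qed

lemma conn_Un:
  assumes "A \<union> B \<subseteq> V" "conn A" "conn B" "A \<inter> B \<noteq> {}"
  shows "conn (A \<union> B)"
proof (rule connI_anchor[of A])
  obtain z where z: "z \<in> A" "z \<in> B" using assms by blast
  fix y assume y: "y \<in> A \<union> B"
  show "\<exists>x\<in>A. (y, x) \<in> (adj (A \<union> B))\<^sup>*"
  proof (cases "y \<in> A")
    case False
    then have "(y, z) \<in> (adj B)\<^sup>*" using assms z y by (auto simp: conn_def)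
    then have "(y, z) \<in> (adj (A \<union> B))\<^sup>*" using rtrancl_adj_mono[of y z B "A \<union> B"] by blast
    then show ?thesis using z by blast
  qed auto
qed (use assms in auto)

lemma nonsep_conn_minus: "nonsep X \<Longrightarrow> conn (X - {w})"
  by (cases "w \<in> X") (auto simp: nonsep_def)

text \<open>Deleting one vertex leaves \<open>x\<close> or \<open>y\<close>, and through it the two
  remainders stay connected.\<close>

lemma nonsep_Un:
  assumes "A \<union> B \<subseteq> V" "nonsep A" "nonsep B" "x \<in> A \<inter> B" "y \<in> A \<inter> B" "x \<noteq> y"
  shows "nonsep (A \<union> B)"
  unfolding nonsep_def
proof (intro conjI ballI)
  show "conn (A \<union> B)" using assms by (intro conn_Un) (auto simp: nonsep_def)
  fix w
  have "x \<in> (A - {w}) \<inter> (B - {w}) \<or> y \<in> (A - {w}) \<inter> (B - {w})"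
    using assms by auto
  then have "(A - {w}) \<inter> (B - {w}) \<noteq> {}" by blast
  then have "conn ((A - {w}) \<union> (B - {w}))"
    using assms by (intro conn_Un nonsep_conn_minus) auto
  then show "conn (A \<union> B - {w})" by (simp add: Un_Diff)
qed

text \<open>After deletion of \<open>w\<close>, a vertex of the path still reaches
  \<open>e 0\<close> or \<open>e L\<close>, on the side where \<open>w\<close> is not. Inner
  vertices of the path may lie in \<open>S\<close>, so that the lemma also applies to an arbitrary
  geodesic between two vertices of \<open>S\<close>.\<close>

lemma nonsep_path_Un:
  assumes S: "nonsep S" "S \<subseteq> V" "e 0 \<in> S" "e L \<in> S" and e: "e ` {..L} \<subseteq> V" "inj_on e {..L}"
    "\<And>i. i < L \<Longrightarrow> d (e i) (e (Suc i)) = 1" "0 < L"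
  shows "nonsep (S \<union> e ` {..L})"
proof -
  have ne: "e 0 \<noteq> e L" using e(2,4) by (auto simp: inj_on_def)
  have V: "S \<union> e ` {..L} \<subseteq> V" using assms by auto
  have up: "(e i, e j) \<in> (adj Y)\<^sup>*" if "i \<le> j" "j \<le> L" "e ` {i..j} \<subseteq> Y" for i j Y
    using that
  proof (induction j rule: dec_induct)
    case (step j)
    have "(e i, e j) \<in> (adj Y)\<^sup>*"
      using step.IH step.hyps step.prems by (meson Suc_leD atLeastatMost_subset_iff image_mono le_SucI order_refl order_trans)
    moreover have "(e j, e (Suc j)) \<in> adj Y"
      using step e(3)[of j] by (auto simp: adj_def image_subset_iff)
    ultimately show ?case by (rule rtrancl_into_rtrancl)
  qed auto
  have main: "conn (S \<union> e ` {..L} - {w})" for w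
  proof (rule connI_anchor[of "S - {w}"])
    fix y assume y: "y \<in> S \<union> e ` {..L} - {w}"
    show "\<exists>x\<in>S - {w}. (y, x) \<in> (adj (S \<union> e ` {..L} - {w}))\<^sup>*"
    proof (cases "y \<in> S")
      case True
      then show ?thesis using y by blast
    next
      case False
      then obtain i where i: "y = e i" "i \<le> L" using y by auto
      show ?thesis
      proof (cases "w \<in> e ` {..i}")
        case True
        then obtain j where j: "w = e j" "j \<le> i" by auto
        then have "e ` {i..L} \<subseteq> S \<union> e ` {..L} - {w}"
          using i y inj_onD[OF e(2), of _ j] by fastforce
        moreover have "e L \<in> e ` {i..L}" using i by simp
        ultimately have "(y, e L) \<in> (adj (S \<union> e ` {..L} - {w}))\<^sup>*" "e L \<noteq> w"
          using up[of i L] i by blast+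
        then show ?thesis using S by blast
      next
        case False
        then have "e ` {0..i} \<subseteq> S \<union> e ` {..L} - {w}" using i by auto
        moreover have "e 0 \<in> e ` {0..i}" by simp
        ultimately have "e 0 \<noteq> w" "(e 0, y) \<in> (adj (S \<union> e ` {..L} - {w}))\<^sup>*"
          using up[of 0 i] i by blast+
        then have "(y, e 0) \<in> (adj (S \<union> e ` {..L} - {w}))\<^sup>*"
          using rtrancl_adj_sym[of "S \<union> e ` {..L} - {w}" "e 0" y] V by blast
        then show ?thesis using S \<open>e 0 \<noteq> w\<close> by blast
      qed
    qed
  qed (use V nonsep_conn_minus[OF S(1)] in auto)
  \<comment> \<open>Deleting a vertex outside the set does not change it; if there is no such
    vertex, the set is \<open>V\<close>.\<close>
  have "conn (S \<union> e ` {..L})"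
  proof (cases "S \<union> e ` {..L} = V")
    case True
    then show ?thesis using conn_V by simp
  next
    case False
    then obtain w where "w \<notin> S \<union> e ` {..L}" using V by blast
    then show ?thesis using main[of w] by simp
  qed
  then show ?thesis using main by (simp add: nonsep_def)
qed

lemma first_hit:
  assumes "(u, w) \<in> (adj Y)\<^sup>*" "w \<in> Q" "u \<in> Y - Q"
  shows "\<exists>p q. (u, p) \<in> (adj (Y - Q))\<^sup>* \<and> p \<in> Y - Q \<and> q \<in> Y \<inter> Q \<and> d p q = 1"
  using assms(1,3)
proof (induction rule: converse_rtrancl_induct)
  case base
  then show ?case using assms by blast
next
  case (step u v)
  show ?case
  proof (cases "v \<in> Q")
    case True
    then show ?thesis using step by (auto simp: adj_def)
  next
    case False
    then have "v \<in> Y - Q" using step by (auto simp: adj_def)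
    then obtain p q where "(v, p) \<in> (adj (Y - Q))\<^sup>*" "p \<in> Y - Q" "q \<in> Y \<inter> Q" "d p q = 1"
      using step.IH by blast
    moreover have "(u, v) \<in> adj (Y - Q)" using step \<open>v \<in> Y - Q\<close> by (auto simp: adj_def)
    ultimately show ?thesis by (meson converse_rtrancl_into_rtrancl)
  qed
qed

text \<open>Walk from \<open>u\<close> until \<open>Q\<close> is first met, at \<open>q\<close>;
  then walk from \<open>u\<close> again with \<open>q\<close> deleted, which meets \<open>Q\<close>
  elsewhere, and join the two walks at \<open>u\<close>. With \<open>X = V\<close> and
  \<open>Q = S\<close> this yields an ear of \<open>S\<close>; with \<open>X = S\<close> it yields a
  walk inside \<open>S\<close> around the neighbours of a new vertex.\<close>

lemma exists_detour:
  assumes "nonsep X" "X \<subseteq> V" "u \<in> X - Q" "a \<in> X \<inter> Q" "b \<in> X \<inter> Q" "a \<noteq> b"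
  shows "\<exists>q q' p p'. q \<in> X \<inter> Q \<and> q' \<in> X \<inter> Q \<and> q \<noteq> q' \<and> p \<in> X - Q \<and> p' \<in> X - Q \<and>
    d q p = 1 \<and> (p, p') \<in> (adj (X - Q))\<^sup>* \<and> d p' q' = 1"
proof -
  have "(u, a) \<in> (adj X)\<^sup>*" using assms by (auto simp: nonsep_def conn_def)
  then obtain p q where p: "(u, p) \<in> (adj (X - Q))\<^sup>*" "p \<in> X - Q" "q \<in> X \<inter> Q" "d p q = 1"
    using first_hit[of u a X Q] assms by blast
  obtain c where c: "c \<in> X \<inter> Q" "c \<noteq> q" using assms by blast
  have "conn (X - {q})" using assms p by (auto simp: nonsep_def)
  then have "(u, c) \<in> (adj (X - {q}))\<^sup>*" using assms c p by (auto simp: conn_def)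
  then obtain p' q' where p': "(u, p') \<in> (adj (X - {q} - Q))\<^sup>*" "p' \<in> X - {q} - Q"
      "q' \<in> (X - {q}) \<inter> Q" "d p' q' = 1"
    using first_hit[of u c "X - {q}" Q] assms c p by blast
  have eq: "X - {q} - Q = X - Q" using p(3) by blast
  have "X - Q \<subseteq> V" using assms(2) by blast
  then have "(p, u) \<in> (adj (X - Q))\<^sup>*" using p(1) by (rule rtrancl_adj_sym)
  then have "(p, p') \<in> (adj (X - Q))\<^sup>*" using p'(1) unfolding eq by (rule rtrancl_trans)
  moreover have "d q p = 1" using p(2-4) assms(2) by (metis dist_sym DiffD1 IntD1 subsetD)
  moreover have "q' \<in> X \<inter> Q" "q \<noteq> q'" "p' \<in> X - Q" using p'(2,3) by blast+
  ultimately show ?thesis using p(2,3) p'(4) by blast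
qed

text \<open>A geodesic is cut at its first vertex in \<open>S\<close>, if there is one; the rest is
  again a geodesic, hence the equation for the length.\<close>

lemma geodesic_first_hit:
  assumes "S \<subseteq> V" "v \<in> V - S" "y \<in> V"
  shows "(v, y) \<in> adj (V - S) ^^ d v y \<or>
    (\<exists>x\<in>S. \<exists>q n. (v, q) \<in> adj (V - S) ^^ n \<and> d q x = 1 \<and> d v y = n + 1 + d x y)"
  using assms(2)
proof (induction "d v y" arbitrary: v)
  case 0
  then show ?case using dist_eq_0 assms by simp
next
  case (Suc k)
  then obtain w where w: "w \<in> V" "d v w = 1" "d v y = Suc (d w y)"
    using dist_step[of v y] assms by fastforce
  show ?case
  proof (cases "w \<in> S")
    case True
    have "(v, v) \<in> adj (V - S) ^^ 0 \<and> d v w = 1 \<and> d v y = 0 + 1 + d w y" using w by simp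
    then show ?thesis using True by blast
  next
    case False
    have vw: "(v, w) \<in> adj (V - S)" using w False Suc.prems by (auto simp: adj_def)
    have "(w, y) \<in> adj (V - S) ^^ d w y \<or>
      (\<exists>x\<in>S. \<exists>q n. (w, q) \<in> adj (V - S) ^^ n \<and> d q x = 1 \<and> d w y = n + 1 + d x y)"
      using Suc w False by auto
    then show ?thesis
    proof
      assume "(w, y) \<in> adj (V - S) ^^ d w y"
      then show ?thesis using vw relpow_Suc_I2[of v w] w by metis
    next
      assume "\<exists>x\<in>S. \<exists>q n. (w, q) \<in> adj (V - S) ^^ n \<and> d q x = 1 \<and> d w y = n + 1 + d x y"
      then obtain x q n where *: "x \<in> S" "(w, q) \<in> adj (V - S) ^^ n" "d q x = 1" "d w y = n + 1 + d x y"
        by blast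
      then have "(v, q) \<in> adj (V - S) ^^ Suc n" using vw relpow_Suc_I2[of v w] by metis
      then show ?thesis using * w by (metis add_Suc)
    qed
  qed
qed

end

subsection \<open>Shortest ears\<close>

text \<open>A walk of \<open>n\<close> steps outside \<open>S\<close> gives an ear with
  \<open>n + 2\<close> edges, so \<open>shortest\<close> states minimality over all pairs of
  distinct ends. Comparing with walks amounts to comparing with paths, since cutting out repetitions
  only shortens a walk.\<close>

locale shortest_ear = graph_metric +
  fixes S :: "'a set" and e :: "nat \<Rightarrow> 'a" and L :: nat
  assumes S_subset: "S \<subseteq> V"
    and ends_in_S: "e 0 \<in> S" "e L \<in> S" "e 0 \<noteq> e L"
    and two_le_L: "2 \<le> L"
    and inner: "\<And>i. \<lbrakk>0 < i; i < L\<rbrakk> \<Longrightarrow> e i \<in> V - S"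
    and path: "\<And>i. i < L \<Longrightarrow> d (e i) (e (Suc i)) = 1"
    and shortest: "\<And>s t p q n. \<lbrakk>s \<in> S; t \<in> S; s \<noteq> t; d s p = 1; (p, q) \<in> adj (V - S) ^^ n;
      p \<in> V - S; d q t = 1\<rbrakk> \<Longrightarrow> L \<le> n + 2"
begin

lemma ear_in_V: "i \<le> L \<Longrightarrow> e i \<in> V"
  using ends_in_S S_subset inner[of i] by (cases "i = 0 \<or> i = L") auto

lemma inner_walk:
  assumes "0 < i" "i \<le> j" "j < L"
  shows "(e i, e j) \<in> adj (V - S) ^^ (j - i)"
  using assms(2,1,3)
proof (induction j rule: dec_induct)
  case (step j)
  then have "(e j, e (Suc j)) \<in> adj (V - S)"
    using inner[of j] inner[of "Suc j"] path[of j] by (auto simp: adj_def)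
  then show ?case using step by (auto simp: Suc_diff_le)
qed simp

lemma shortest_ear_rev: "shortest_ear V d S (\<lambda>i. e (L - i)) L"
proof
  fix i assume "i < L"
  then show "d (e (L - i)) (e (L - Suc i)) = 1"
    using path[of "L - Suc i"] dist_sym[of "e (L - i)" "e (L - Suc i)"] ear_in_V
    by (simp add: Suc_diff_Suc)
qed (use S_subset ends_in_S two_le_L inner shortest in auto)

text \<open>A walk that leaves the ear at \<open>e i\<close> and ends in \<open>x\<close> forms a
  new ear with the part of the old one before \<open>e i\<close> or after it, unless the ends
  coincide.\<close>

lemma ear_to_S:
  assumes i: "0 < i" "i < L" and q: "(e i, q) \<in> adj (V - S) ^^ n" "x \<in> S" "d q x = 1"
  shows "x \<noteq> e 0 \<Longrightarrow> L \<le> i + n + 1" "x \<noteq> e L \<Longrightarrow> i \<le> n + 1"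
proof -
  have qV: "q \<in> V - S" using relpow_adj_in[OF q(1)] inner i by blast
  show "L \<le> i + n + 1" if "x \<noteq> e 0"
  proof -
    have "(e 1, q) \<in> adj (V - S) ^^ ((i - 1) + n)"
      using inner_walk[of 1 i] i q(1) unfolding relpow_add by auto
    then have "L \<le> (i - 1 + n) + 2"
      using that ends_in_S q i inner[of 1] path[of 0] by (intro shortest[of "e 0" x "e 1" q]) auto
    then show ?thesis using i by simp
  qed
  show "i \<le> n + 1" if "x \<noteq> e L"
  proof -
    have "(q, e i) \<in> adj (V - S) ^^ n" using q(1) by (rule relpow_adj_sym[rotated]) blast
    then have "(q, e (L - 1)) \<in> adj (V - S) ^^ (n + (L - 1 - i))"
      using inner_walk[of i "L - 1"] i unfolding relpow_add by auto
    moreover have "d x q = 1" using q qV S_subset dist_sym by (metis DiffD1 subsetD)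
    ultimately have "L \<le> (n + (L - 1 - i)) + 2"
      using that ends_in_S q i qV path[of "L - 1"] by (intro shortest[of x "e L" q "e (L - 1)"]) auto
    then show ?thesis using i by simp
  qed
qed

text \<open>The alternatives say where a geodesic from \<open>e i\<close> first meets
  \<open>S\<close>: at \<open>e 0\<close>, at \<open>e L\<close>, or elsewhere, in which case
  minimality compares it with both parts of the ear.\<close>

lemma dist_ear_S:
  assumes "0 < i" "i < L" "y \<in> S"
  shows "i + d (e 0) y \<le> d (e i) y \<or> L - i + d (e L) y \<le> d (e i) y \<or>
    i \<le> d (e i) y \<and> L - i \<le> d (e i) y"
proof -
  have ei: "e i \<in> V - S" using inner assms by blast
  have "(e i, y) \<notin> adj (V - S) ^^ d (e i) y"
    using relpow_adj_in[where a = "e i" and b = y and X = "V - S"] ei assms by blast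
  then obtain x q n where x: "x \<in> S" "(e i, q) \<in> adj (V - S) ^^ n" "d q x = 1" "d (e i) y = n + 1 + d x y"
    using geodesic_first_hit[OF S_subset ei, of y] assms S_subset by blast
  then show ?thesis
    using ear_to_S[OF assms(1,2) x(2,1,3)] ends_in_S(3) by (cases "x = e 0"; cases "x = e L") auto
qed

lemma dist_ear_le: "\<lbrakk>i \<le> j; j \<le> L\<rbrakk> \<Longrightarrow> d (e i) (e j) \<le> j - i"
proof (induction j rule: dec_induct)
  case (step j)
  then have "d (e i) (e (Suc j)) \<le> d (e i) (e j) + d (e j) (e (Suc j))"
    using ear_in_V by (intro dist_triangle) auto
  then show ?case using step path[of j] by simp
qed (simp add: ear_in_V)

lemma dist_ear_around_le:
  assumes "i \<le> j" "j \<le> L"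
  shows "d (e i) (e j) \<le> i + d (e 0) (e L) + (L - j)"
proof -
  have "d (e i) (e j) \<le> d (e i) (e 0) + d (e 0) (e j)"
    "d (e 0) (e j) \<le> d (e 0) (e L) + d (e L) (e j)"
    using assms ear_in_V by (auto intro!: dist_triangle)
  moreover have "d (e i) (e 0) \<le> i" "d (e L) (e j) \<le> L - j"
    using assms dist_ear_le[of 0 i] dist_ear_le[of j L] dist_sym[of "e i" "e 0"]
      dist_sym[of "e L" "e j"] ear_in_V by auto
  ultimately show ?thesis by linarith
qed

lemma ends_dist: "0 < d (e 0) (e L)" "d (e 0) (e L) \<le> L"
  using ends_in_S dist_eq_0[of "e 0" "e L"] ear_in_V[of 0] ear_in_V[of L] dist_ear_le[of 0 L] by auto

text \<open>Together with the two upper bounds: the distance of two ear vertices is the shorter way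
  round, as on an isometric cycle of length \<open>L + d (e 0) (e L)\<close> formed by the ear and a
  geodesic between its ends.\<close>

lemma dist_ear_ge:
  assumes "i \<le> j" "j \<le> L"
  shows "j - i \<le> d (e i) (e j) \<or> i + d (e 0) (e L) + (L - j) \<le> d (e i) (e j)"
proof -
  define \<delta> where "\<delta> = d (e 0) (e L)"
  have sym: "d (e j) (e i) = d (e i) (e j)" "d (e L) (e 0) = \<delta>"
    using assms ear_in_V dist_sym by (auto simp: \<delta>_def)
  have to_0: "k \<le> d (e k) (e 0) \<or> L - k + \<delta> \<le> d (e k) (e 0)" if "0 < k" "k < L" for k
    using dist_ear_S[OF that ends_in_S(1)] ear_in_V[of 0] sym by auto
  have to_L: "k + \<delta> \<le> d (e k) (e L) \<or> L - k \<le> d (e k) (e L)" if "0 < k" "k < L" for k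
    using dist_ear_S[OF that ends_in_S(2)] ear_in_V[of L] \<delta>_def by auto
  consider "i = j" | "i = 0" "j = L" | "i = 0" "0 < j" "j < L" | "0 < i" "i < L" "j = L"
    | "0 < i" "i < L" "0 < j" "j < L" "i < j"
    using assms by linarith
  then show ?thesis
  proof cases
    case 5
    have ei: "e i \<in> V - S" "e j \<in> V - S" using inner 5 by auto
    consider "(e i, e j) \<in> adj (V - S) ^^ d (e i) (e j)"
      | x q n where "x \<in> S" "(e i, q) \<in> adj (V - S) ^^ n" "d q x = 1" "d (e i) (e j) = n + 1 + d x (e j)"
      using geodesic_first_hit[OF S_subset ei(1), of "e j"] ei by blast
    then show ?thesis
    proof cases
      case 1
      \<comment> \<open>This geodesic avoids \<open>S\<close>, so it can replace the part of the ear
        between \<open>e i\<close> and \<open>e j\<close>.\<close>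
      have "(e 1, e j) \<in> adj (V - S) ^^ ((i - 1) + d (e i) (e j))"
        using inner_walk[of 1 i] 1 5 unfolding relpow_add by auto
      then have "(e 1, e (L - 1)) \<in> adj (V - S) ^^ ((i - 1) + d (e i) (e j) + (L - 1 - j))"
        using inner_walk[of j "L - 1"] 5 unfolding relpow_add by auto
      then have "L \<le> ((i - 1) + d (e i) (e j) + (L - 1 - j)) + 2"
        using ends_in_S inner[of 1] path[of 0] path[of "L - 1"] 5
        by (intro shortest[of "e 0" "e L" "e 1" "e (L - 1)"]) auto
      then show ?thesis using 5 by linarith
    next
      case 2
      note * = ear_to_S[OF 5(1,2) 2(2,1,3)]
      show ?thesis
      proof (cases "x = e 0")
        case True
        then have "i \<le> n + 1" using * ends_in_S by auto
        then show ?thesis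
          using to_0[of j] 2 True 5 dist_sym[of "e 0" "e j"] ear_in_V by (auto simp: \<delta>_def)
      next
        case False
        then show ?thesis using * 2 5 by auto
      qed
    qed
  qed (use to_0[of j] to_L[of i] dist_sym[of "e 0" "e j"] ear_in_V assms in \<open>auto simp: \<delta>_def\<close>)
qed

lemma inj_on_ear: "inj_on e {..L}"
proof (rule linorder_inj_onI)
  fix i j assume "i < j" "i \<in> {..L}" "j \<in> {..L}"
  then have "0 < d (e i) (e j)"
    using dist_ear_ge[of i j] ends_dist by auto
  then show "e i \<noteq> e j" using ear_in_V \<open>i \<in> {..L}\<close> by force
qed auto

text \<open>The geodesics from a vertex near the middle of the ear to the two ends leave it on different
  sides, so the switch happens inside the old set.\<close>

lemma middle_gain:
  assumes X: "X \<subseteq> S" "(e 0, e L) \<in> (adj X)\<^sup>*" "e 0 \<in> X" and L: "3 \<le> L"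
    and i: "0 < i" "i < L" "L \<le> 2 * i + d (e 0) (e L)" "2 * i \<le> L + d (e 0) (e L)"
  shows "2 \<le> (\<Sum>y\<in>X. excess (e i) y)"
proof (rule two_le_sum_excess[where q = "e (i - 1)" and q' = "e (i + 1)" and a = "e 0" and b = "e L"])
  show "e L \<in> X" using X rtrancl_adj_in by blast
  show "e i \<notin> X" using inner i X by blast
  have "0 < d (e (i - 1)) (e (i + 1))"
    using dist_ear_ge[of "i - 1" "i + 1"] ends_dist i by linarith
  then show "e (i - 1) \<noteq> e (i + 1)" using ear_in_V[of "i + 1"] i by force
  show "d (e i) (e (i - 1)) = 1" "d (e i) (e (i + 1)) = 1"
    using path[of "i - 1"] path[of i] i dist_sym[of "e i" "e (i - 1)"] ear_in_V by auto
  have "d (e i) (e 0) = i"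
    using dist_ear_le[of 0 i] dist_ear_ge[of 0 i] i dist_sym[of "e 0" "e i"] ear_in_V by auto
  moreover have "d (e 0) (e (i - 1)) = i - 1"
    using dist_ear_le[of 0 "i - 1"] dist_ear_ge[of 0 "i - 1"] i by linarith
  moreover have "d (e (i - 1)) (e 0) = d (e 0) (e (i - 1))"
    using i ear_in_V by (intro dist_sym) auto
  ultimately show "d (e i) (e 0) = Suc (d (e (i - 1)) (e 0))" using i by simp
  have "d (e i) (e L) = L - i" "d (e (i + 1)) (e L) = L - (i + 1)"
    using dist_ear_le[of i L] dist_ear_ge[of i L] dist_ear_le[of "i + 1" L] dist_ear_ge[of "i + 1" L] i by auto
  then show "d (e i) (e L) = Suc (d (e (i + 1)) (e L))" using i by simp
  fix u u' assume u: "u \<in> X" "u' \<in> X" "d u u' = 1" "d (e i) u = 1"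
  show "d (e i) u' \<noteq> 1"
  proof
    assume u': "d (e i) u' = 1"
    have "u \<in> V" "u' \<in> V" "e i \<in> V" using u X S_subset ear_in_V i by auto
    moreover from this have "u \<noteq> u'" "d u (e i) = 1" using u dist_sym by (force, metis)
    ultimately have "L \<le> 0 + 2"
      using u u' X inner i by (intro shortest[of u u' "e i" "e i"]) auto
    then show False using L by simp
  qed
qed (use X S_subset ear_in_V i in auto)

text \<open>For a vertex \<open>e i\<close> so close to \<open>e 0\<close> that its geodesics to \<open>e L\<close> run through \<open>e 0\<close>, the edges
  of the longer arc from \<open>e i\<close> to \<open>e L\<close> opposite to both of them are good.\<close>

lemma ear_good_arc:
  assumes "0 < i" "i + d (e 0) (e L) < L - i" "L \<le> i + (i + d (e 0) (e L)) + 2 * m"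
    "2 * m + 2 \<le> L + d (e 0) (e L)"
  shows "d (e i) (e (i + m)) = m" "d (e i) (e (i + Suc m)) = Suc m"
    "d (e (i + m)) (e L) = L - i - m" "d (e (i + Suc m)) (e L) = L - i - Suc m"
    "i + Suc m \<le> L"
proof -
  show *: "i + Suc m \<le> L" using assms by linarith
  show "d (e i) (e (i + m)) = m" using dist_ear_le[of i "i + m"] dist_ear_ge[of i "i + m"] assms * by auto
  show "d (e i) (e (i + Suc m)) = Suc m"
    using dist_ear_le[of i "i + Suc m"] dist_ear_ge[of i "i + Suc m"] assms * by auto
  show "d (e (i + m)) (e L) = L - i - m"
    using dist_ear_le[of "i + m" L] dist_ear_ge[of "i + m" L] assms * by auto
  show "d (e (i + Suc m)) (e L) = L - i - Suc m"
    using dist_ear_le[of "i + Suc m" L] dist_ear_ge[of "i + Suc m" L] assms * by auto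
qed

text \<open>On a cycle, two vertices at distance \<open>k\<close> have \<open>k\<close> good edges
  on the longer arc if the length of the cycle is even, and \<open>k - 1\<close> if it is odd. Here
  \<open>k = i + d (e 0) (e L)\<close> is at least 2, so fewer than two such edges remain only for
  \<open>k = 2\<close> on an odd cycle.\<close>

lemma left_excess:
  assumes "0 < i" "i + d (e 0) (e L) < L - i"
  shows "1 \<le> excess (e i) (e L)"
    and "even (L + d (e 0) (e L)) \<or> 3 \<le> i + d (e 0) (e L) \<Longrightarrow> 2 \<le> excess (e i) (e L)"
proof -
  define \<delta> where "\<delta> = d (e 0) (e L)"
  \<comment> \<open>The least \<open>m\<close> for which going on along the ear from
    \<open>e (i + m)\<close> to \<open>e L\<close> is no longer than the way back through
    \<open>e 0\<close>.\<close>
  define m where "m = (L - i - (i + \<delta>) + 1) div 2"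
  have d: "0 < \<delta>" using ends_dist \<delta>_def by simp
  have m: "L \<le> i + (i + \<delta>) + 2 * m" "2 * m + 2 \<le> L + \<delta>"
    using assms d by (auto simp: m_def \<delta>_def[symmetric])
  note m1 = ear_good_arc[OF assms, folded \<delta>_def, OF m]
  have iL: "d (e i) (e L) = i + \<delta>"
    using dist_ear_around_le[of i L] dist_ear_ge[of i L] assms unfolding \<delta>_def by linarith
  have V: "e i \<in> V" "e L \<in> V" "e (i + m) \<in> V" "e (i + Suc m) \<in> V" using m1(5) ear_in_V by auto
  have s: "d (e L) (e (i + m)) = L - i - m" "d (e L) (e (i + Suc m)) = L - i - Suc m"
    using m1 V dist_sym by metis+
  show "1 \<le> excess (e i) (e L)"
    using V m1 s iL path[of "i + m"] assms by (intro one_le_excess[of _ _ "e (i + m)" "e (i + Suc m)"]) (auto simp: \<delta>_def)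
  assume "even (L + d (e 0) (e L)) \<or> 3 \<le> i + d (e 0) (e L)"
  then have m': "L \<le> i + (i + \<delta>) + 2 * Suc m" "2 * Suc m + 2 \<le> L + \<delta>"
    using m assms d by (auto simp: m_def \<delta>_def[symmetric]; presburger)+
  note m2 = ear_good_arc[OF assms, folded \<delta>_def, OF m']
  have V': "e (i + Suc (Suc m)) \<in> V" using m2(5) ear_in_V by auto
  have s': "d (e L) (e (i + Suc (Suc m))) = L - i - Suc (Suc m)"
    using m2 V V' dist_sym by metis
  have "e (i + m) \<noteq> e (i + Suc m)" using m1 by auto
  then show "2 \<le> excess (e i) (e L)"
    using V m1 s iL path[of "i + m"] path[of "i + Suc m"] m2 V' s' assms
    by (intro two_le_excess[of _ _ "e (i + m)" "e (i + Suc m)" "e (i + Suc m)" "e (i + Suc (Suc m))"])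
       (auto simp: \<delta>_def)
qed

text \<open>On this cycle of length \<open>2 * h + 1\<close> the edge between \<open>e 0\<close> and
  \<open>e L\<close> lies on the longer arc from \<open>e 1\<close> to \<open>e (Suc h)\<close> and
  is good for them. It supplies the unit that \<open>left_excess\<close> leaves open at
  \<open>e 1\<close>.\<close>

lemma opposite_excess:
  assumes "d (e 0) (e L) = 1" "L = 2 * h" "2 \<le> h"
  shows "1 \<le> excess (e 1) (e (Suc h))"
proof (rule one_le_excess[of _ _ "e 0" "e L"])
  have "d (e 1) (e 0) = 1" "d (e 1) (e L) = 2" "d (e L) (e (Suc h)) = h - 1" "d (e 0) (e (Suc h)) = h"
    "d (e 1) (e (Suc h)) = h"
    using path[of 0] dist_sym[of "e 1" "e 0"] dist_ear_around_le[of 1 L] dist_ear_ge[of 1 L]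
      dist_ear_le[of "Suc h" L] dist_ear_ge[of "Suc h" L]
      dist_ear_around_le[of 0 "Suc h"] dist_ear_ge[of 0 "Suc h"]
      dist_ear_le[of 1 "Suc h"] dist_ear_ge[of 1 "Suc h"] dist_sym[of "e L" "e (Suc h)"] ear_in_V assms by auto
  then show "d (e 1) (e 0) < d (e 1) (e L)" "d (e (Suc h)) (e L) < d (e (Suc h)) (e 0)"
    "d (e 1) (e (Suc h)) < d (e 1) (e 0) + d (e 0) (e (Suc h))"
    using dist_sym[of "e (Suc h)" "e L"] dist_sym[of "e (Suc h)" "e 0"] ear_in_V assms by auto
qed (use assms ear_in_V in auto)

end

lemma (in graph_metric) excess_le_sum:
  assumes "x \<in> V" "M \<subseteq> V" "a \<in> M"
  shows "excess x a \<le> (\<Sum>y\<in>M. excess x y)"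
  using sum_excess_mono[of x "{a}" M] assms by simp

lemma (in graph_metric) excess2_le_sum:
  assumes "x \<in> V" "M \<subseteq> V" "a \<in> M" "b \<in> M" "a \<noteq> b"
  shows "excess x a + excess x b \<le> (\<Sum>y\<in>M. excess x y)"
  using sum_excess_mono[of x "{a, b}" M] assms by simp

lemma (in graph_metric) excess3_le_sum:
  assumes "x \<in> V" "M \<subseteq> V" "a \<in> M" "b \<in> M" "c \<in> M" "a \<noteq> b" "a \<noteq> c" "b \<noteq> c"
  shows "excess x a + excess x b + excess x c \<le> (\<Sum>y\<in>M. excess x y)"
  using sum_excess_mono[of x "{a, b, c}" M] assms by simp

context shortest_ear begin

text \<open>\<open>opp\<close> serves the case in which \<open>left_excess\<close> finds a single
  unit: \<open>i = 1\<close> on an odd cycle over an edge. For \<open>L = 4\<close> the vertex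
  \<open>e (Suc h)\<close> would be \<open>e 3\<close>, which by symmetry waits for
  \<open>e 1\<close>; hence the exclusion of the pentagon.\<close>

lemma left_gain:
  assumes "0 < i" "i + d (e 0) (e L) < L - i" "M \<subseteq> V" "e L \<in> M" "\<not> (L = 4 \<and> d (e 0) (e L) = 1)"
    and opp: "\<And>h. \<lbrakk>i = 1; L = 2 * h; 3 \<le> h\<rbrakk> \<Longrightarrow> e (Suc h) \<in> M"
  shows "2 \<le> (\<Sum>y\<in>M. excess (e i) y)"
proof -
  have V: "e i \<in> V" using assms ear_in_V by simp
  show ?thesis
  proof (cases "even (L + d (e 0) (e L)) \<or> 3 \<le> i + d (e 0) (e L)")
    case True
    then show ?thesis
      using left_excess(2)[OF assms(1,2)] excess_le_sum[OF V assms(3,4)] by simp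
  next
    case False
    then have i: "i = 1" "d (e 0) (e L) = 1" "odd (L + d (e 0) (e L))"
      using ends_dist assms by auto
    then obtain h where h: "L = 2 * h" by auto
    moreover have "h \<noteq> 2" using assms(5) h i by auto
    ultimately have "3 \<le> h" using assms(2) i by linarith
    then have "e (Suc h) \<in> M" "1 \<le> excess (e i) (e (Suc h))"
      using opp h i opposite_excess[of h] by auto
    moreover have "e (Suc h) \<noteq> e L" using inj_onD[OF inj_on_ear, of "Suc h" L] h \<open>3 \<le> h\<close> by auto
    ultimately show ?thesis
      using left_excess(1)[OF assms(1,2)] excess2_le_sum[OF V assms(3,4), of "e (Suc h)"] by simp
  qed
qed

text \<open>An inner vertex gains by \<open>left_gain\<close>, by its mirror image, or by
  \<open>middle_gain\<close>, according to whether its geodesics to one of the ends must run through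
  the other end. \<open>X\<close> may be smaller than \<open>S\<close>: the first cycle over a
  maximal clique takes from the clique only the two ends of the ear.\<close>

lemma ear_gain:
  assumes X: "X \<subseteq> S" "e 0 \<in> X" "e L \<in> X" "(e 0, e L) \<in> (adj X)\<^sup>*"
    and L: "3 \<le> L" "\<not> (L = 4 \<and> d (e 0) (e L) = 1)"
  shows "total X + 4 * (int L - 1) \<le> total (X \<union> e ` {0<..<L})"
proof -
  interpret rev: shortest_ear V d S "\<lambda>i. e (L - i)" L by (rule shortest_ear_rev)
  have "inj_on e {0<..<L}" using inj_on_ear by (rule inj_on_subset) auto
  then have card: "card (e ` {0<..<L}) = L - 1" by (simp add: card_image)
  have sub: "X \<union> e ` {0<..<L} \<subseteq> V" using X S_subset ear_in_V by auto
  have \<delta>: "d (e L) (e 0) = d (e 0) (e L)" by (rule dist_sym) (auto intro: ear_in_V)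
  have "total X + 4 * int (card (e ` {0<..<L})) \<le> total (X \<union> e ` {0<..<L})"
  proof (rule total_extend)
    have "e i \<notin> X" if "0 < i" "i < L" for i using inner[OF that] X(1) by blast
    then show "X \<inter> e ` {0<..<L} = {}" by auto
    fix M assume M: "X \<subseteq> M" "M \<subset> X \<union> e ` {0<..<L}"
    have MV: "M \<subseteq> V" using M sub by blast
    show "\<exists>x\<in>X \<union> e ` {0<..<L} - M. 2 \<le> (\<Sum>y\<in>M. excess x y)"
    proof (rule ccontr)
      assume "\<not> ?thesis"
      then have *: "e i \<in> M" if "0 < i" "i < L" "2 \<le> (\<Sum>y\<in>M. excess (e i) y)" for i
        using that by auto
      have ends: "e L \<in> M" "e 0 \<in> M" using X M by auto
      have left: "e i \<in> M" if "0 < i" "i + d (e 0) (e L) < L - i"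
          "\<And>h. \<lbrakk>i = 1; L = 2 * h; 3 \<le> h\<rbrakk> \<Longrightarrow> e (Suc h) \<in> M" for i
      proof (rule *)
        show "2 \<le> (\<Sum>y\<in>M. excess (e i) y)"
          by (rule left_gain[OF that(1,2) MV ends(1) L(2)]) (rule that(3))
      qed (use that in auto)
      have right: "e i \<in> M" if "i < L" "L - i + d (e 0) (e L) < i"
          "\<And>h. \<lbrakk>L - i = 1; L = 2 * h; 3 \<le> h\<rbrakk> \<Longrightarrow> e (L - Suc h) \<in> M" for i
      proof (rule *)
        have "2 \<le> (\<Sum>y\<in>M. excess (e (L - (L - i))) y)"
          by (rule rev.left_gain) (use that MV ends L \<delta> in auto)
        then show "2 \<le> (\<Sum>y\<in>M. excess (e i) y)" using that by simp
      qed (use that in auto)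
      have mid: "e i \<in> M" if "0 < i" "i < L" "L \<le> 2 * i + d (e 0) (e L)" "2 * i \<le> L + d (e 0) (e L)" for i
      proof -
        have "2 \<le> (\<Sum>y\<in>X. excess (e i) y)" using middle_gain[OF X(1,4,2) L(1) that] .
        also have "\<dots> \<le> (\<Sum>y\<in>M. excess (e i) y)"
          using that M MV ear_in_V by (intro sum_excess_mono) auto
        finally show ?thesis using * that by blast
      qed
      \<comment> \<open>The vertices next to the ends come last, since \<open>e 1\<close> may need
        \<open>e (Suc h)\<close> and \<open>e (L - 1)\<close> may need \<open>e (L - Suc h)\<close>.
        For \<open>3 \<le> h\<close> both are among the vertices treated here.\<close>
      have most: "e i \<in> M" if i: "1 < i" "i < L - 1" for i
      proof -
        consider "i + d (e 0) (e L) < L - i" | "L - i + d (e 0) (e L) < i"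
          | "L \<le> 2 * i + d (e 0) (e L)" "2 * i \<le> L + d (e 0) (e L)" using i by linarith
        then show ?thesis
        proof cases
          case 1
          show ?thesis by (rule left[OF _ 1]) (use that in \<open>auto\<close>)
        next
          case 2
          show ?thesis by (rule right[OF _ 2]) (use that in \<open>auto\<close>)
        next
          case 3
          show ?thesis by (rule mid[OF _ _ 3]) (use that in auto)
        qed
      qed
      have "e i \<in> M" if i: "0 < i" "i < L" for i
      proof -
        consider "i + d (e 0) (e L) < L - i" | "L - i + d (e 0) (e L) < i"
          | "L \<le> 2 * i + d (e 0) (e L)" "2 * i \<le> L + d (e 0) (e L)" using i by linarith
        then show ?thesis
        proof cases
          case 1
          show ?thesis by (rule left[OF _ 1]) (use that in \<open>auto intro!: most\<close>)
        next
          case 2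
          show ?thesis by (rule right[OF _ 2]) (use that in \<open>auto intro!: most\<close>)
        next
          case 3
          show ?thesis by (rule mid[OF _ _ 3]) (use that in auto)
        qed
      qed
      then show False using M by auto
    qed
  qed (rule sub)
  then show ?thesis using card L by (simp add: of_nat_diff)
qed

text \<open>An ear that closes a pentagon over an edge of the old set is exceptional: inside the pentagon
  its three vertices gain five units only, and a sixth comes from a further vertex of the old set.\<close>

lemma pentagon_excess:
  assumes "L = 4" "d (e 0) (e L) = 1"
  shows "1 \<le> excess (e 1) (e 4)" "1 \<le> excess (e 3) (e 0)" "1 \<le> excess (e 1) (e 3)"
    "1 \<le> excess (e 2) (e 4)" "1 \<le> excess (e 2) (e 0)"
proof -
  interpret rev: shortest_ear V d S "\<lambda>i. e (L - i)" L by (rule shortest_ear_rev)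
  have \<delta>: "d (e L) (e 0) = d (e 0) (e L)" by (rule dist_sym) (auto intro: ear_in_V)
  show "1 \<le> excess (e 1) (e 4)" using left_excess(1)[of 1] assms by simp
  show "1 \<le> excess (e 3) (e 0)" using rev.left_excess(1)[of 1] assms \<delta> by simp
  show "1 \<le> excess (e 1) (e 3)" using opposite_excess[of 2] assms by (simp add: eval_nat_numeral)
  have V: "e 0 \<in> V" "e 1 \<in> V" "e 2 \<in> V" "e 3 \<in> V" "e 4 \<in> V" using ear_in_V assms by auto
  have D: "d (e 0) (e 2) = 2" "d (e 2) (e 4) = 2" "d (e 1) (e 2) = 1" "d (e 2) (e 3) = 1" "d (e 0) (e 1) = 1"
    "d (e 3) (e 4) = 1" "d (e 1) (e 4) = 2" "d (e 0) (e 3) = 2"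
    using dist_ear_le[of 0 2] dist_ear_ge[of 0 2] dist_ear_le[of 2 4] dist_ear_ge[of 2 4]
      path[of 0] path[of 1] path[of 2] path[of 3] dist_ear_around_le[of 1 4] dist_ear_ge[of 1 4]
      dist_ear_around_le[of 0 3] dist_ear_ge[of 0 3] assms
    by (auto simp: eval_nat_numeral)
  have D': "d (e 2) (e 0) = 2" "d (e 4) (e 0) = 1" "d (e 1) (e 0) = 1" "d (e 2) (e 1) = 1" "d (e 3) (e 0) = 2"
    using D V dist_sym assms by metis+
  show "1 \<le> excess (e 2) (e 4)"
    by (rule horizontal_excess[of "e 2" "e 0" "e 4" "e 1"]) (use V D D' assms in auto)
  show "1 \<le> excess (e 2) (e 0)"
    by (rule horizontal_excess[of "e 2" "e 4" "e 0" "e 3"]) (use V D D' assms in auto)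
qed

text \<open>\<open>d (e 0) y\<close> is 1 or 2 and \<open>d (e 2) y\<close> is 2 or 3. For the
  values 2, 3 the edge \<open>e 2\<close>, \<open>e 3\<close> is good for \<open>e 1\<close> and
  \<open>y\<close>; for 2, 2 there are geodesics from \<open>e 1\<close> through \<open>e 0\<close>
  and \<open>e 2\<close>; for 1, 3 from \<open>e 2\<close> through \<open>e 1\<close> and
  \<open>e 3\<close>; for 1, 2 the edge from \<open>e 2\<close> to a common neighbour
  \<open>w\<close> of \<open>e 2\<close> and \<open>y\<close> is good for \<open>e 1\<close> and
  \<open>y\<close>.\<close>

lemma pentagon_extra:
  assumes L: "L = 4" "d (e 0) (e L) = 1" and y: "y \<in> S" "y \<noteq> e 0" "y \<noteq> e L" "d y (e L) = 1"
  shows "1 \<le> excess (e 1) y \<or> 2 \<le> excess (e 2) y"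
proof -
  have V: "e 0 \<in> V" "e 1 \<in> V" "e 2 \<in> V" "e 3 \<in> V" "e 4 \<in> V" "y \<in> V" using ear_in_V L y S_subset by auto
  have p: "d (e 0) (e 1) = 1" "d (e 1) (e 2) = 1" "d (e 2) (e 3) = 1" "d (e 3) (e 4) = 1" "d (e 0) (e 4) = 1"
    "d y (e 4) = 1" "d (e 1) (e 3) = 2"
    using path[of 0] path[of 1] path[of 2] path[of 3] dist_ear_le[of 1 3] dist_ear_ge[of 1 3] L y
    by (auto simp: eval_nat_numeral)
  have p': "d (e 1) (e 0) = 1" "d (e 2) (e 1) = 1" "d (e 3) (e 2) = 1" "d (e 4) y = 1" "d (e 0) y \<noteq> 0"
    "d (e 4) y \<noteq> 0"
    using p V dist_sym y dist_eq_0 by metis+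
  have sy: "d y (e i) = d (e i) y" if "i \<le> L" for i
    using that V dist_sym ear_in_V by auto
  have d3: "d (e 3) y = 2" "2 \<le> d (e 2) y" "2 \<le> d (e 1) y" "d (e 1) y = d (e 0) y + 1 \<or> 3 \<le> d (e 1) y"
    using dist_ear_S[of 1 y] dist_ear_S[of 2 y] dist_ear_S[of 3 y] dist_triangle[of "e 3" "e 4" y]
      dist_triangle[of "e 1" "e 0" y] V y L p p' by auto
  have t: "d (e 2) y \<le> d (e 2) (e 3) + d (e 3) y" "d (e 1) y \<le> d (e 1) (e 0) + d (e 0) y"
    "d (e 0) y \<le> d (e 0) (e 4) + d (e 4) y"
    using V by (auto intro!: dist_triangle)
  consider "d (e 0) y = 2" "d (e 2) y = 3" | "d (e 0) y = 2" "d (e 2) y = 2"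
    | "d (e 0) y = 1" "d (e 2) y = 3" | "d (e 0) y = 1" "d (e 2) y = 2"
    using t p p' d3 by linarith
  then show ?thesis
  proof cases
    case 1
    then have "1 \<le> excess (e 1) y"
      using V p p' d3 t sy[of 2] sy[of 3] L
      by (intro one_le_excess[of "e 1" y "e 2" "e 3"]) auto
    then show ?thesis by simp
  next
    case 2
    have "e 0 \<noteq> e 2" using inj_onD[OF inj_on_ear, of 0 2] L by auto
    then have "2 \<le> excess (e 1) y"
      using V p p' d3 t 2 by (intro two_geodesics[of "e 1" y "e 0" "e 2"]) auto
    then show ?thesis by simp
  next
    case 3
    have "e 1 \<noteq> e 3" using inj_onD[OF inj_on_ear, of 1 3] L by auto
    then have "2 \<le> excess (e 2) y"
      using V p p' d3 t 3 by (intro two_geodesics[of "e 2" y "e 1" "e 3"]) auto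
    then show ?thesis by simp
  next
    case 4
    have "e 2 \<noteq> y" using inner[of 2] y L by auto
    then obtain w where w: "w \<in> V" "d (e 2) w = 1" "d (e 2) y = Suc (d w y)"
      using dist_step[of "e 2" y] V by blast
    have "w \<notin> S"
    proof
      assume "w \<in> S"
      then show False using dist_ear_S[of 2 w] L w by auto
    qed
    have "d (e 1) w \<noteq> 0"
    proof
      assume "d (e 1) w = 0"
      then have "w = e 1" using w V dist_eq_0 by blast
      then show False using w 4 d3 by auto
    qed
    \<comment> \<open>Otherwise \<open>e 0\<close>, \<open>e 1\<close>, \<open>w\<close>,
      \<open>y\<close> would be an ear of length 3.\<close>
    moreover have "d (e 1) w \<noteq> 1"
    proof
      assume "d (e 1) w = 1"
      then have "(e 1, w) \<in> adj (V - S) ^^ 1"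
        using \<open>w \<notin> S\<close> w inner[of 1] L by (auto simp: adj_def)
      then have "L \<le> 1 + 2"
        using 4 w p y ends_in_S inner[of 1] L by (intro shortest[of "e 0" y "e 1" w]) auto
      then show False using L by simp
    qed
    moreover have "d y w = 1" using w V 4 dist_sym by auto
    ultimately have "1 \<le> excess (e 1) y"
      using V w p d3 t p' 4 sy[of 2] L by (intro one_le_excess[of "e 1" y "e 2" w]) auto
    then show ?thesis by simp
  qed
qed

text \<open>The five diagonals of the pentagon give one unit each, and doubled they make 10. A
  vertex of \<open>X\<close> adjacent to an end of the ear supplies the sixth unit and so reaches
  \<open>4 * (L - 1) = 12\<close>.\<close>

lemma pentagon_gain:
  assumes L: "L = 4" "d (e 0) (e L) = 1" and X: "X \<subseteq> S" "e 0 \<in> X" "e L \<in> X"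
  shows "total X + 10 \<le> total (X \<union> e ` {0<..<L})"
    and "\<lbrakk>y \<in> X; y \<noteq> e 0; y \<noteq> e L; d y (e 0) = 1 \<or> d y (e L) = 1\<rbrakk> \<Longrightarrow>
      total X + 12 \<le> total (X \<union> e ` {0<..<L})"
proof -
  interpret rev: shortest_ear V d S "\<lambda>i. e (L - i)" L by (rule shortest_ear_rev)
  have \<delta>: "d (e L) (e 0) = d (e 0) (e L)" by (rule dist_sym) (auto intro: ear_in_V)
  have V: "e 0 \<in> V" "e 1 \<in> V" "e 2 \<in> V" "e 3 \<in> V" "e 4 \<in> V" "X \<subseteq> V" using ear_in_V L X S_subset by auto
  have ne: "e i \<noteq> e j" if "i \<noteq> j" "i \<le> 4" "j \<le> 4" for i j
    using inj_onD[OF inj_on_ear, of i j] that L by auto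
  have nX: "e 1 \<notin> X" "e 2 \<notin> X" "e 3 \<notin> X" using inner[of 1] inner[of 2] inner[of 3] X(1) L(1) by auto
  have "{0<..<L} = {1, 2, 3}" using L by auto
  then have "X \<union> e ` {0<..<L} = insert (e 1) (insert (e 3) (insert (e 2) X))" by auto
  moreover have "total (insert (e 1) (insert (e 3) (insert (e 2) X))) =
    total (insert (e 3) (insert (e 2) X)) + 2 * (\<Sum>y\<in>insert (e 3) (insert (e 2) X). excess (e 1) y)"
    using V nX ne by (intro total_insert) auto
  moreover have "total (insert (e 3) (insert (e 2) X)) = total (insert (e 2) X) + 2 * (\<Sum>y\<in>insert (e 2) X. excess (e 3) y)"
    using V nX ne by (intro total_insert) auto
  moreover have "total (insert (e 2) X) = total X + 2 * (\<Sum>y\<in>X. excess (e 2) y)"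
    using V nX ne by (intro total_insert) auto
  moreover have "(\<Sum>y\<in>X. excess (e 3) y) \<le> (\<Sum>y\<in>insert (e 2) X. excess (e 3) y)"
    using V by (intro sum_excess_mono) auto
  moreover have "(\<Sum>y\<in>insert (e 3) X. excess (e 1) y) \<le> (\<Sum>y\<in>insert (e 3) (insert (e 2) X). excess (e 1) y)"
    using V by (intro sum_excess_mono) auto
  moreover have "(\<Sum>y\<in>insert (e 3) X. excess (e 1) y) = excess (e 1) (e 3) + (\<Sum>y\<in>X. excess (e 1) y)"
    using nX V finite_in_V by (intro sum.insert) auto
  ultimately have tot: "total X + 2 * ((\<Sum>y\<in>X. excess (e 1) y) + (\<Sum>y\<in>X. excess (e 2) y) +
      (\<Sum>y\<in>X. excess (e 3) y) + excess (e 1) (e 3)) \<le> total (X \<union> e ` {0<..<L})"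
    by simp
  note pent = pentagon_excess[OF L]
  have X': "e 0 \<in> X" "e 4 \<in> X" "e 0 \<noteq> e 4" using X L ends_in_S by auto
  have base: "excess (e 1) (e 4) \<le> (\<Sum>y\<in>X. excess (e 1) y)"
    using V X' by (intro excess_le_sum)
  have base': "excess (e 3) (e 0) \<le> (\<Sum>y\<in>X. excess (e 3) y)"
    using V X' by (intro excess_le_sum)
  have base'': "excess (e 2) (e 0) + excess (e 2) (e 4) \<le> (\<Sum>y\<in>X. excess (e 2) y)"
    using V X' by (intro excess2_le_sum)
  show "total X + 10 \<le> total (X \<union> e ` {0<..<L})"
    using tot pent base base' base'' by simp
  assume y: "y \<in> X" "y \<noteq> e 0" "y \<noteq> e L" "d y (e 0) = 1 \<or> d y (e L) = 1"
  then have extra: "1 \<le> excess (e 1) y \<or> 2 \<le> excess (e 2) y \<or> 1 \<le> excess (e 3) y"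
    using pentagon_extra[OF L, of y] rev.pentagon_extra[of y] L \<delta> X by auto
  have y4: "y \<noteq> e 4" "y \<in> V" using y L V by auto
  have "excess (e 1) (e 4) + excess (e 1) y \<le> (\<Sum>y\<in>X. excess (e 1) y)"
    using V X' y y4 by (intro excess2_le_sum) auto
  moreover have "excess (e 3) (e 0) + excess (e 3) y \<le> (\<Sum>y\<in>X. excess (e 3) y)"
    using V X' y y4 by (intro excess2_le_sum) auto
  moreover have "excess (e 2) (e 0) + excess (e 2) (e 4) + excess (e 2) y \<le> (\<Sum>y\<in>X. excess (e 2) y)"
    using V X' y y4 by (intro excess3_le_sum) auto
  moreover have "0 \<le> excess (e 1) y" "0 \<le> excess (e 2) y" "0 \<le> excess (e 3) y"
    using V y4 by (simp_all add: excess_nonneg)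
  ultimately show "total X + 12 \<le> total (X \<union> e ` {0<..<L})"
    using extra tot pent by auto
qed

end

subsection \<open>Growing a set by ears\<close>

context graph_metric begin

lemma exists_shortest_ear:
  assumes "nonsep V" "S \<subseteq> V" "S \<noteq> V" "a \<in> S" "b \<in> S" "a \<noteq> b"
  shows "\<exists>e L. shortest_ear V d S e L"
proof -
  define P where "P n \<longleftrightarrow> (\<exists>s t p q. s \<in> S \<and> t \<in> S \<and> s \<noteq> t \<and> d s p = 1 \<and>
    (p, q) \<in> adj (V - S) ^^ n \<and> p \<in> V - S \<and> d q t = 1)" for n
  obtain u where "u \<in> V - S" using assms by blast
  then obtain q q' p p' where *: "q \<in> V \<inter> S" "q' \<in> V \<inter> S" "q \<noteq> q'" "p \<in> V - S"
    "d q p = 1" "(p, p') \<in> (adj (V - S))\<^sup>*" "d p' q' = 1"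
    using exists_detour[OF assms(1), of u S a b] assms by blast
  then obtain n where "(p, p') \<in> adj (V - S) ^^ n" using rtrancl_imp_relpow by blast
  then have "P n" unfolding P_def using * by blast
  then have "P (LEAST n. P n)" by (rule LeastI)
  moreover define m where "m = (LEAST n. P n)"
  ultimately obtain s t p q where m: "s \<in> S" "t \<in> S" "s \<noteq> t" "d s p = 1"
    "(p, q) \<in> adj (V - S) ^^ m" "p \<in> V - S" "d q t = 1"
    unfolding P_def by blast
  have least: "m \<le> n" if "P n" for n using that by (simp add: m_def Least_le)
  obtain f where f: "f 0 = p" "f m = q" "\<And>i. i < m \<Longrightarrow> (f i, f (Suc i)) \<in> adj (V - S)"
    using m(5) unfolding relpow_fun_conv by blast
  define e where "e i = (if i = 0 then s else if i \<le> Suc m then f (i - 1) else t)" for i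
  have fV: "f i \<in> V - S" if "i \<le> m" for i
    using that f m by (cases i) (auto simp: adj_def dest!: f(3))
  have "shortest_ear V d S e (m + 2)"
  proof
    fix i assume "i < m + 2"
    then consider "i = 0" | j where "i = Suc j" "j < m" | "i = Suc m"
      by (metis One_nat_def Suc_lessI add.commute add_Suc less_Suc_eq_0_disj less_antisym plus_1_eq_Suc one_add_one)
    then show "d (e i) (e (Suc i)) = 1"
    proof cases
      case 2
      then show ?thesis using f(3)[of j] by (auto simp: e_def adj_def)
    qed (use m f in \<open>auto simp: e_def\<close>)
  next
    fix s t p q n
    assume "s \<in> S" "t \<in> S" "s \<noteq> t" "d s p = 1" "(p, q) \<in> adj (V - S) ^^ n" "p \<in> V - S" "d q t = 1"
    then have "P n" unfolding P_def by blast
    then show "m + 2 \<le> n + 2" using least by simp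
  qed (use assms m fV in \<open>auto simp: e_def\<close>)
  then show ?thesis by blast
qed

lemma grow:
  assumes V: "nonsep V" and S: "S \<subseteq> V" "S \<noteq> V" "nonsep S" "4 * int (card S) - 12 \<le> total S"
    and xz: "x \<in> S" "z \<in> S" "d x z = 2"
    and common: "\<And>w. \<lbrakk>w \<in> V; d x w = 1; d w z = 1\<rbrakk> \<Longrightarrow> w \<in> S"
  shows "\<exists>S'. S \<subset> S' \<and> S' \<subseteq> V \<and> nonsep S' \<and> 4 * int (card S') - 12 \<le> total S'"
proof -
  have VV: "x \<in> V" "z \<in> V" using xz S by auto
  then have "x \<noteq> z" using xz by auto
  then obtain e L where "shortest_ear V d S e L"
    using exists_shortest_ear[OF V S(1,2) xz(1,2)] by blast
  then interpret shortest_ear V d S e L .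
  have "{..L} = insert 0 (insert L {0<..<L})" using two_le_L by auto
  then have ear: "S \<union> e ` {..L} = S \<union> e ` {0<..<L}" using ends_in_S by auto
  have "e ` {..L} \<subseteq> V" using ear_in_V by auto
  then have nonsep': "nonsep (S \<union> e ` {0<..<L})"
    using nonsep_path_Un[OF S(3,1) ends_in_S(1,2) _ inj_on_ear path] two_le_L by (simp add: ear)
  have sub: "S \<union> e ` {0<..<L} \<subseteq> V" using S ear_in_V by auto
  have disj: "e i \<notin> S" if "0 < i" "i < L" for i using inner[OF that] by blast
  have "inj_on e {0<..<L}" using inj_on_ear by (rule inj_on_subset) auto
  then have "card (e ` {0<..<L}) = L - 1" by (simp add: card_image)
  moreover have "S \<inter> e ` {0<..<L} = {}" using disj by auto
  ultimately have card: "card (S \<union> e ` {0<..<L}) = card S + (L - 1)"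
    using finite_in_V[OF S(1)] by (simp add: card_Un_disjoint)
  have "total S + 4 * (int L - 1) \<le> total (S \<union> e ` {0<..<L})"
  proof -
    consider "L = 2" | "L = 4" "d (e 0) (e L) = 1" | "3 \<le> L" "\<not> (L = 4 \<and> d (e 0) (e L) = 1)"
      using two_le_L by linarith
    then show ?thesis
    proof cases
      case 1
      define Q where "Q = {q. d (e 1) q = 1}"
      have e1: "e 1 \<in> V - S" "d (e 1) (e 0) = 1" "d (e 1) (e 2) = 1"
        using inner[of 1] path[of 0] path[of 1] 1 dist_sym[of "e 0" "e 1"] ear_in_V
        by (auto simp: numeral_2_eq_2)
      \<comment> \<open>By \<open>common\<close>, the new vertex is not adjacent to both
        \<open>x\<close> and \<open>z\<close>.\<close>
      have "\<exists>u. u \<in> S - Q"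
      proof (rule ccontr)
        assume "\<nexists>u. u \<in> S - Q"
        then have "d (e 1) x = 1" "d (e 1) z = 1" using xz by (auto simp: Q_def)
        then show False using common[of "e 1"] e1 dist_sym[of x "e 1"] VV by auto
      qed
      then obtain u where "u \<in> S - Q" by blast
      \<comment> \<open>The walk from \<open>p\<close> to \<open>p'\<close> stays at distance at
        least 2 from \<open>e 1\<close>, so no triangle with \<open>e 1\<close> can arise, while its
        ends have geodesics from \<open>e 1\<close> through the different neighbours
        \<open>q\<close> and \<open>q'\<close>.\<close>
      then obtain q q' p p' where q: "q \<in> S \<inter> Q" "q' \<in> S \<inter> Q" "q \<noteq> q'" "p \<in> S - Q" "p' \<in> S - Q"
        "d q p = 1" "(p, p') \<in> (adj (S - Q))\<^sup>*" "d p' q' = 1"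
        using exists_detour[OF S(3,1), of u Q "e 0" "e 2"] e1 ends_in_S 1 by (auto simp: Q_def)
      have qV: "q \<in> V" "q' \<in> V" "p \<in> V" "p' \<in> V" "e 1 \<in> V" using q e1 S by auto
      have far: "2 \<le> d (e 1) y" if "y \<in> S - Q" for y
      proof -
        have "d (e 1) y \<noteq> 1" using that by (simp add: Q_def)
        moreover have "d (e 1) y \<noteq> 0" using dist_eq_0[of "e 1" y] that e1 S by auto
        ultimately show ?thesis by linarith
      qed
      have nb: "d (e 1) q = 1" "d (e 1) q' = 1" "d q' p' = 1"
        using q qV dist_sym[of q' p'] by (auto simp: Q_def)
      have "d (e 1) p = 2" "d (e 1) p' = 2"
        using far[of p] far[of p'] dist_triangle[of "e 1" q p] dist_triangle[of "e 1" q' p'] q qV nb by auto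
      then have "2 \<le> (\<Sum>y\<in>S - Q. excess (e 1) y)"
        using q qV nb e1 S by (intro two_le_sum_excess[of _ _ q q' p p']) (auto simp: Q_def)
      also have "\<dots> \<le> (\<Sum>y\<in>S. excess (e 1) y)"
        using qV S by (intro sum_excess_mono) auto
      finally have "total S + 4 \<le> total (insert (e 1) S)"
        using total_insert[of "e 1" S] e1 S by auto
      moreover have "{0<..<L} = {1}" using 1 by auto
      ultimately show ?thesis using 1 by simp
    next
      case 2
      \<comment> \<open>\<open>x\<close>, \<open>z\<close> and a common neighbour are three vertices
        of \<open>S\<close>, so one of them is not an end of the ear; a detour from it finds a
        vertex adjacent to an end, as the sixth unit requires.\<close>
      obtain w where w: "w \<in> V" "d x w = 1" "d x z = Suc (d w z)"
        using dist_step[OF VV \<open>x \<noteq> z\<close>] by blast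
      have wz: "d w z = 1" using w(3) xz(3) by simp
      have w': "w \<in> S" using common w(1,2) wz by blast
      have "w \<noteq> x" "w \<noteq> z" using w(2) wz VV dist_self by force+
      obtain u where "u \<in> S - {e 0, e L}" using w' \<open>w \<noteq> x\<close> \<open>w \<noteq> z\<close> xz \<open>x \<noteq> z\<close> by blast
      then obtain q p where "q \<in> S \<inter> {e 0, e L}" "p \<in> S - {e 0, e L}" "d q p = 1"
        using exists_detour[OF S(3,1), of u "{e 0, e L}" "e 0" "e L"] ends_in_S by blast
      moreover from this have "d p q = 1" using dist_sym S by (metis DiffD1 IntD1 subsetD)
      ultimately show ?thesis
        using pentagon_gain(2)[OF 2 order_refl ends_in_S(1,2), of p] 2 by auto
    next
      case 3
      have "(e 0, e L) \<in> (adj S)\<^sup>*" using S ends_in_S by (auto simp: nonsep_def conn_def)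
      then show ?thesis using ear_gain[OF order_refl ends_in_S(1,2) _ 3] by blast
    qed
  qed
  then have "4 * int (card (S \<union> e ` {0<..<L})) - 12 \<le> total (S \<union> e ` {0<..<L})"
    using S(4) two_le_L unfolding card by simp
  moreover have "e 1 \<in> S \<union> e ` {0<..<L} - S" using inner[of 1] two_le_L by auto
  ultimately show ?thesis using nonsep' sub by blast
qed

section \<open>Starting sets and the bound for a nonseparable graph\<close>

lemma conn_singleton: "conn {a}"
  by (simp add: conn_def)

text \<open>The pair \<open>x\<close>, \<open>z\<close> alone suffices. Each of the \<open>k\<close>
  common neighbours lies on two geodesic arcs of its own, so the excess is at least
  \<open>2 * k - 2\<close>; doubled, this is exactly \<open>4 * (k + 2) - 12\<close>.\<close>

lemma start_common_neighbours:
  assumes xz: "x \<in> V" "z \<in> V" "d x z = 2"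
    and w: "w \<in> V" "w' \<in> V" "w \<noteq> w'" "d x w = 1" "d w z = 1" "d x w' = 1" "d w' z = 1"
  defines "S \<equiv> insert x (insert z {w \<in> V. d x w = 1 \<and> d w z = 1})"
  shows "nonsep S" "4 * int (card S) - 12 \<le> total S"
proof -
  define W where "W = {w \<in> V. d x w = 1 \<and> d w z = 1}"
  have S: "S = insert x (insert z W)" by (simp add: S_def W_def)
  have SV: "S \<subseteq> V" using xz by (auto simp: S W_def)
  have fin: "finite W" using finite_V by (simp add: W_def)
  have ww: "w \<in> W" "w' \<in> W" using w by (auto simp: W_def)
  have ne: "x \<noteq> z" "x \<notin> W" "z \<notin> W" using xz by (auto simp: W_def)
  have arcs: "d x v = 1" "d v x = 1" "d v z = 1" "d z v = 1" if "v \<in> W" for v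
    using that xz dist_sym[of x v] dist_sym[of v z] by (auto simp: W_def)
  have conn: "conn (S - {u})" for u
  proof (cases "u = x")
    case True
    show ?thesis
    proof (rule connI_anchor[of "{z}"])
      fix y assume "y \<in> S - {u}"
      then have "y = z \<or> (y, z) \<in> adj (S - {u})" using arcs True ne by (auto simp: adj_def S)
      then show "\<exists>x\<in>{z}. (y, x) \<in> (adj (S - {u}))\<^sup>*" by auto
    qed (use True ne SV conn_singleton in \<open>auto simp: S\<close>)
  next
    case False
    obtain v where v: "v \<in> W" "v \<noteq> u" using ww w by blast
    show ?thesis
    proof (rule connI_anchor[of "{x}"])
      fix y assume y: "y \<in> S - {u}"
      show "\<exists>x\<in>{x}. (y, x) \<in> (adj (S - {u}))\<^sup>*"
      proof (cases "y = z")
        case True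
        then have "(y, v) \<in> adj (S - {u})" "(v, x) \<in> adj (S - {u})"
          using arcs False y v by (auto simp: adj_def S)
        then show ?thesis by (meson converse_rtrancl_into_rtrancl r_into_rtrancl singletonI)
      next
        case zF: False
        then have "y = x \<or> (y, x) \<in> adj (S - {u})" using arcs y False by (auto simp: adj_def S)
        then show ?thesis by auto
      qed
    qed (use False SV conn_singleton in \<open>auto simp: S\<close>)
  qed
  have "conn ((S - {w}) \<union> (S - {w'}))"
    by (rule conn_Un) (use conn SV ww ne w in \<open>auto simp: S\<close>)
  moreover have "(S - {w}) \<union> (S - {w'}) = S" using w by auto
  ultimately show "nonsep S" using conn by (simp add: nonsep_def)
  have "(x, v) \<in> geodesic_arcs x z" "(v, z) \<in> geodesic_arcs x z" if "v \<in> W" for v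
    using arcs[OF that] that xz by (simp_all add: geodesic_arcs_def W_def)
  then have in_arcs: "Pair x ` W \<union> (\<lambda>v. (v, z)) ` W \<subseteq> geodesic_arcs x z" by blast
  have "2 * card W = card (Pair x ` W \<union> (\<lambda>v. (v, z)) ` W)"
    using fin ne by (subst card_Un_disjoint) (auto simp: card_image inj_on_def)
  also have "\<dots> \<le> card (geodesic_arcs x z)"
    using in_arcs by (intro card_mono) auto
  also have "\<dots> \<le> card (good x z)"
    using geodesic_arcs_subset_good xz by (intro card_mono) auto
  finally have "2 * int (card W) - 2 \<le> excess x z"
    using xz by (simp add: excess_def)
  moreover have "total {x, z} = 2 * excess x z"
    using ne excess_self[OF xz(1)] excess_self[OF xz(2)] excess_sym[OF xz(2,1)] by (simp add: total_def)
  moreover have "total {x, z} \<le> total S" using SV by (intro total_mono) (auto simp: S)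
  moreover have "card S = card W + 2" using ne fin by (simp add: S)
  ultimately show "4 * int (card S) - 12 \<le> total S" by simp
qed

text \<open>An ear over a clique has adjacent ends. Length 2 is impossible: by maximality some
  \<open>y\<close> in \<open>K\<close> is not adjacent to \<open>e 1\<close>, and both
  \<open>e 0\<close> and \<open>e 2\<close> would be common neighbours of the two. In length 3 the
  same holds for \<open>e 1\<close> and \<open>e 3\<close>. In the longer cycle, \<open>e 1\<close>
  and \<open>e L\<close> are at distance 2 with \<open>e 0\<close> as their only common
  neighbour.\<close>

lemma start_cycle:
  assumes V: "nonsep V" and ab: "a \<in> V" "b \<in> V" "2 \<le> d a b"
    and uniq: "\<And>x z w w'. \<lbrakk>x \<in> V; z \<in> V; w \<in> V; w' \<in> V; d x z = 2; d x w = 1; d w z = 1;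
      d x w' = 1; d w' z = 1\<rbrakk> \<Longrightarrow> w = w'"
  shows "\<exists>S x z. S \<subseteq> V \<and> nonsep S \<and> 4 * int (card S) - 12 \<le> total S \<and> x \<in> S \<and> z \<in> S \<and> d x z = 2 \<and>
    (\<forall>w\<in>V. d x w = 1 \<and> d w z = 1 \<longrightarrow> w \<in> S)"
proof -
  define clique where "clique K \<longleftrightarrow> K \<subseteq> V \<and> (\<forall>u\<in>K. \<forall>v\<in>K. u \<noteq> v \<longrightarrow> d u v = 1)" for K
  have "a \<noteq> b" using ab by auto
  then obtain c where c: "c \<in> V" "d a c = 1" using dist_step[OF ab(1,2)] by blast
  then have "clique {a, c}" using ab dist_sym[of a c] by (auto simp: clique_def)
  moreover have "finite {K. clique K}"
    by (rule finite_subset[of _ "Pow V"]) (auto simp: clique_def finite_V)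
  ultimately obtain K where K: "clique K" "{a, c} \<subseteq> K" "\<And>K'. clique K' \<Longrightarrow> K \<subseteq> K' \<Longrightarrow> K' = K"
    using finite_has_maximal2[of "{K. clique K}" "{a, c}"] by auto
  have KV: "K \<subseteq> V" using K by (simp add: clique_def)
  have "K \<noteq> V" using ab \<open>a \<noteq> b\<close> K by (force simp: clique_def)
  moreover have "a \<noteq> c" using c ab by auto
  ultimately obtain e L where "shortest_ear V d K e L"
    using exists_shortest_ear[OF V KV, of a c] K by blast
  then interpret shortest_ear V d K e L .
  have \<delta>: "d (e 0) (e L) = 1" "d (e L) (e 0) = 1" using K ends_in_S by (auto simp: clique_def)
  have far: "d (e 1) (e L) = 2" if "L \<noteq> 2"
    using dist_ear_around_le[of 1 L] dist_ear_ge[of 1 L] that two_le_L \<delta> by auto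
  have inV: "e 0 \<in> V" "e 1 \<in> V" "e 2 \<in> V" "e L \<in> V" using ear_in_V two_le_L by auto
  have e10: "d (e 1) (e 0) = 1" using path[of 0] dist_sym[of "e 0" "e 1"] inV two_le_L by simp
  have "L \<noteq> 2"
  proof
    assume L: "L = 2"
    have e12: "d (e 1) (e 2) = 1" using path[of 1] L by (simp add: numeral_2_eq_2)
    have "\<exists>y\<in>K. d (e 1) y \<noteq> 1"
    proof (rule ccontr)
      assume "\<not> ?thesis"
      then have 1: "d (e 1) y = 1" if "y \<in> K" for y using that by blast
      then have "d y (e 1) = 1" if "y \<in> K" for y
        using that KV inV dist_sym[of y "e 1"] by auto
      then have "clique (insert (e 1) K)"
        using 1 K(1) inV by (simp add: clique_def)
      then have "e 1 \<in> K" using K(3)[of "insert (e 1) K"] by blast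
      then show False using inner[of 1] L by simp
    qed
    then obtain y where y: "y \<in> K" "d (e 1) y \<noteq> 1" by blast
    have yV: "y \<in> V" using y KV by auto
    have ne: "y \<noteq> e 0" "y \<noteq> e 2" "y \<noteq> e 1" using y e10 e12 inner[of 1] L by auto
    have dy: "d (e 0) y = 1" "d (e 2) y = 1" using K(1) y ends_in_S ne L by (auto simp: clique_def)
    have "d (e 1) y \<noteq> 0" using dist_eq_0[of "e 1" y] inV yV ne by auto
    then have "d (e 1) y = 2" using dist_triangle[of "e 1" "e 0" y] inV yV e10 dy y by auto
    then show False using uniq[of "e 1" y "e 0" "e 2"] inV yV e10 e12 dy ends_in_S L by auto
  qed
  have "L \<noteq> 3"
  proof
    assume L: "L = 3"
    have "d (e 1) (e 2) = 1" "d (e 2) (e 3) = 1"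
      using path[of 1] path[of 2] L by (auto simp: eval_nat_numeral)
    then have "e 0 = e 2"
      using uniq[of "e 1" "e 3" "e 0" "e 2"] inV e10 far \<delta> L by auto
    then show False using inj_onD[OF inj_on_ear, of 0 2] L by auto
  qed
  then have L: "4 \<le> L" using \<open>L \<noteq> 2\<close> two_le_L by linarith
  have pair: "(e 0, e L) \<in> adj {e 0, e L}" "(e L, e 0) \<in> adj {e 0, e L}"
    using \<delta> by (auto simp: adj_def)
  have nonsep_pair: "nonsep {e 0, e L}"
  proof -
    have "conn {e 0, e L}" using pair by (auto simp: conn_def)
    moreover have "{e 0, e L} - {e 0} = {e L}" "{e 0, e L} - {e L} = {e 0}" using ends_in_S by auto
    ultimately show ?thesis using conn_singleton by (auto simp: nonsep_def)
  qed
  define S where "S = {e 0, e L} \<union> e ` {0<..<L}"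
  have "{..L} = insert 0 (insert L {0<..<L})" by auto
  then have S: "S = e ` {..L}" "S = {e 0, e L} \<union> e ` {..L}" by (auto simp: S_def)
  have SV: "S \<subseteq> V" using ear_in_V by (auto simp: S(1))
  have "nonsep S"
    unfolding S(2) using nonsep_pair SV inV inj_on_ear path L S(1) by (intro nonsep_path_Un) auto
  \<comment> \<open>The cycle has \<open>L + 1\<close> vertices and needs only
    \<open>4 * L - 8\<close>, so even the 10 of a pentagon suffice.\<close>
  moreover have "4 * int (card S) - 12 \<le> total S"
  proof -
    have "card S = Suc L" using inj_on_ear by (simp add: S(1) card_image)
    moreover have "0 \<le> total {e 0, e L}"
      unfolding total_def using inV by (intro sum_nonneg excess_nonneg) auto
    moreover have "total {e 0, e L} + 10 \<le> total S" if "L = 4"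
      unfolding S_def using pentagon_gain(1)[OF that \<delta>(1), of "{e 0, e L}"] ends_in_S by auto
    moreover have "total {e 0, e L} + 4 * (int L - 1) \<le> total S" if "L \<noteq> 4"
      unfolding S_def using ear_gain[of "{e 0, e L}"] ends_in_S pair(1) L that by auto
    ultimately show ?thesis using L by (cases "L = 4") auto
  qed
  moreover have "e 1 \<in> S" "e L \<in> S" "d (e 1) (e L) = 2" using L far by (auto simp: S(1))
  moreover have "w \<in> S" if "w \<in> V" "d (e 1) w = 1" "d w (e L) = 1" for w
  proof -
    have "w = e 0" using uniq[of "e 1" "e L" w "e 0"] that inV e10 \<delta> far L by auto
    then show ?thesis by (auto simp: S(1))
  qed
  ultimately show ?thesis using SV by blast
qed

theorem total_excess_ge:
  assumes V: "nonsep V" and ab: "a \<in> V" "b \<in> V" "2 \<le> d a b"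
  shows "4 * int (card V) - 12 \<le> total V"
proof -
  have "\<exists>S x z. S \<subseteq> V \<and> nonsep S \<and> 4 * int (card S) - 12 \<le> total S \<and> x \<in> S \<and> z \<in> S \<and> d x z = 2 \<and>
    (\<forall>w\<in>V. d x w = 1 \<and> d w z = 1 \<longrightarrow> w \<in> S)"
  proof (cases "\<exists>x\<in>V. \<exists>z\<in>V. \<exists>w\<in>V. \<exists>w'\<in>V. w \<noteq> w' \<and> d x z = 2 \<and> d x w = 1 \<and> d w z = 1 \<and> d x w' = 1 \<and> d w' z = 1")
    case True
    then obtain x z w w' where *: "x \<in> V" "z \<in> V" "d x z = 2" "w \<in> V" "w' \<in> V" "w \<noteq> w'"
      "d x w = 1" "d w z = 1" "d x w' = 1" "d w' z = 1" by blast
    have "insert x (insert z {w \<in> V. d x w = 1 \<and> d w z = 1}) \<subseteq> V" using * by auto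
    then show ?thesis
      using start_common_neighbours[OF *] *(3) by (intro exI conjI) auto
  next
    case False
    show ?thesis by (rule start_cycle[OF V ab]) (use False in blast)
  qed
  then obtain S x z where S: "S \<subseteq> V" "nonsep S" "4 * int (card S) - 12 \<le> total S" "x \<in> S" "z \<in> S"
    "d x z = 2" "\<forall>w\<in>V. d x w = 1 \<and> d w z = 1 \<longrightarrow> w \<in> S" by blast
  then show ?thesis
  proof (induction "card (V - S)" arbitrary: S rule: less_induct)
    case less
    show ?case
    proof (cases "S = V")
      case False
      then obtain S' where S': "S \<subset> S'" "S' \<subseteq> V" "nonsep S'" "4 * int (card S') - 12 \<le> total S'"
        using grow[OF V less.prems(1) False less.prems(2-6)] less.prems(7) by blast
      then have "card (V - S') < card (V - S)"
        using finite_V by (intro psubset_card_mono) auto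
      then show ?thesis using less.hyps[of S'] less.prems S' by blast
    qed (use less in simp)
  qed
qed

section \<open>Isometry of maximal nonseparable sets and summation over such sets\<close>

lemma geodesic_walk:
  assumes "a \<in> V" "b \<in> V"
  shows "(a, b) \<in> adj V ^^ d a b"
  using assms
proof (induction "d a b" arbitrary: a)
  case 0
  then show ?case using dist_eq_0 by simp
next
  case (Suc n)
  then have "a \<noteq> b" by auto
  then obtain c where c: "c \<in> V" "d a c = 1" "d a b = Suc (d c b)"
    using dist_step Suc.prems by blast
  then have "(a, c) \<in> adj V" "(c, b) \<in> adj V ^^ d c b"
    using Suc by (auto simp: adj_def)
  then show ?case using c(3) relpow_Suc_I2[of a c "adj V"] by metis
qed

text \<open>A maximal nonseparable set is isometric, because adding a geodesic between two of its
  vertices keeps it nonseparable.\<close>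

lemma maximal_nonsep_metric:
  assumes B: "B \<subseteq> V" "nonsep B" and max: "\<And>S. \<lbrakk>nonsep S; B \<subseteq> S; S \<subseteq> V\<rbrakk> \<Longrightarrow> S = B"
  shows "graph_metric B d"
proof
  show "finite B" using B(1) by (rule finite_in_V)
  fix a b assume "a \<in> B" "b \<in> B"
  then have ab: "a \<in> V" "b \<in> V" using B by auto
  show "d a b = 0 \<longleftrightarrow> a = b" using dist_eq_0[OF ab] .
  show "d a b = d b a" using dist_sym[OF ab] .
  show "\<exists>c\<in>B. d a c = 1 \<and> d a b = Suc (d c b)" if "a \<noteq> b"
  proof -
    obtain f where f: "f 0 = a" "f (d a b) = b" "\<And>i. i < d a b \<Longrightarrow> (f i, f (Suc i)) \<in> adj V"
      using geodesic_walk[OF ab] unfolding relpow_fun_conv by blast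
    have pos: "0 < d a b" using dist_eq_0[OF ab] that by simp
    have fV: "f i \<in> V" if "i \<le> d a b" for i
      using f(3)[of i] that f(2) ab by (cases "i = d a b") (auto simp: adj_def)
    have up: "d a (f i) \<le> i" if "i \<le> d a b" for i
      using that
    proof (induction i)
      case (Suc i)
      have "d a (f (Suc i)) \<le> d a (f i) + d (f i) (f (Suc i))"
        using Suc.prems ab fV by (intro dist_triangle) auto
      then show ?case using Suc f(3)[of i] by (auto simp: adj_def)
    qed (use f ab in simp)
    have down: "d (f (d a b - i)) b \<le> i" if "i \<le> d a b" for i
      using that
    proof (induction i)
      case (Suc i)
      have "d (f (d a b - Suc i)) b \<le> d (f (d a b - Suc i)) (f (d a b - i)) + d (f (d a b - i)) b"
        using Suc.prems ab fV by (intro dist_triangle) auto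
      moreover have "d (f (d a b - Suc i)) (f (d a b - i)) = 1"
        using f(3)[of "d a b - Suc i"] Suc.prems by (simp add: adj_def Suc_diff_Suc)
      ultimately show ?case using Suc by simp
    qed (use f ab in simp)
    \<comment> \<open>By the triangle inequality the two upper bounds, which add up to
      \<open>d a b\<close>, are both sharp.\<close>
    have exact: "d a (f i) = i" "d (f i) b = d a b - i" if "i \<le> d a b" for i
      using up[OF that] down[of "d a b - i"] that dist_triangle[OF ab(1) fV[OF that] ab(2)] by auto
    have "inj_on f {..d a b}"
      using exact(1) by (intro inj_onI) (metis atMost_iff)
    moreover have "f ` {..d a b} \<subseteq> V" using fV by auto
    moreover have "d (f i) (f (Suc i)) = 1" if "i < d a b" for i
      using f(3)[OF that] by (simp add: adj_def)
    ultimately have "nonsep (B \<union> f ` {..d a b})"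
      using B f(1,2) \<open>a \<in> B\<close> \<open>b \<in> B\<close> pos by (intro nonsep_path_Un) auto
    moreover have "B \<union> f ` {..d a b} \<subseteq> V" using B fV by auto
    ultimately have "B \<union> f ` {..d a b} = B" using max[of "B \<union> f ` {..d a b}"] by blast
    then have "f 1 \<in> B" using pos by auto
    then show ?thesis using exact[of 1] pos by (intro bexI[of _ "f 1"]) auto
  qed
  show "d a c \<le> d a b + d b c" if "c \<in> B" for c
    using that ab B by (intro dist_triangle) auto
qed

text \<open>Both excesses subtract the same distance \<open>d x y\<close>, and the larger set can
  only add good edges.\<close>

lemma excess_subset:
  assumes "graph_metric B d" "B \<subseteq> V"
  shows "graph_metric.excess B d x y \<le> excess x y"
proof -
  interpret B: graph_metric B d by fact
  have "B.good x y \<subseteq> good x y" using assms(2) by (auto simp: B.good_def good_def)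
  then have "card (B.good x y) \<le> card (good x y)" by (intro card_mono) auto
  then show ?thesis by (simp add: B.excess_def excess_def)
qed

lemma total_eq_off_diagonal:
  assumes "S \<subseteq> V"
  shows "total S = (\<Sum>(x, y)\<in>{(x, y). x \<in> S \<and> y \<in> S \<and> x \<noteq> y}. excess x y)"
proof -
  have fin: "finite S" using assms by (rule finite_in_V)
  have "total S = (\<Sum>(x, y)\<in>S \<times> S. excess x y)"
    by (simp add: total_def sum.cartesian_product)
  also have "\<dots> = (\<Sum>(x, y)\<in>{(x, y). x \<in> S \<and> y \<in> S \<and> x \<noteq> y}. excess x y)"
  proof (rule sum.mono_neutral_right)
    show "\<forall>i\<in>S \<times> S - {(x, y). x \<in> S \<and> y \<in> S \<and> x \<noteq> y}. (case i of (x, y) \<Rightarrow> excess x y) = 0"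
      using assms excess_self by auto
  qed (use fin in auto)
  finally show ?thesis .
qed

text \<open>Sets that meet in at most one vertex share no ordered pair of distinct vertices; a
  shared vertex does no harm because the diagonal has excess 0.\<close>

lemma sum_total_le:
  assumes fin: "finite F" and F: "\<And>B. B \<in> F \<Longrightarrow> B \<subseteq> V"
    and meet: "\<And>A B x y. \<lbrakk>A \<in> F; B \<in> F; x \<in> A \<inter> B; y \<in> A \<inter> B; x \<noteq> y\<rbrakk> \<Longrightarrow> A = B"
  shows "(\<Sum>B\<in>F. total B) \<le> total V"
proof -
  define D where "D B = {(x, y). x \<in> B \<and> y \<in> B \<and> x \<noteq> y}" for B :: "'a set"
  have finD: "finite (D B)" if "B \<subseteq> V" for B
    by (rule finite_subset[of _ "V \<times> V"]) (use that finite_V in \<open>auto simp: D_def\<close>)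
  have "(\<Sum>B\<in>F. total B) = (\<Sum>B\<in>F. \<Sum>(x, y)\<in>D B. excess x y)"
    using F total_eq_off_diagonal by (intro sum.cong) (auto simp: D_def)
  also have "\<dots> = (\<Sum>(x, y)\<in>(\<Union>B\<in>F. D B). excess x y)"
  proof (rule sum.UNION_disjoint[symmetric])
    show "\<forall>A\<in>F. \<forall>B\<in>F. A \<noteq> B \<longrightarrow> D A \<inter> D B = {}"
      using meet by (fastforce simp: D_def)
  qed (use fin F finD in auto)
  also have "\<dots> \<le> (\<Sum>(x, y)\<in>D V. excess x y)"
  proof (rule sum_mono2)
    show "(\<Union>B\<in>F. D B) \<subseteq> D V" using F by (auto simp: D_def)
    show "0 \<le> (case p of (x, y) \<Rightarrow> excess x y)" if "p \<in> D V - (\<Union>B\<in>F. D B)" for p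
      using that excess_nonneg by (auto simp: D_def)
  qed (use finD in auto)
  also have "\<dots> = total V" by (simp add: total_eq_off_diagonal D_def)
  finally show ?thesis .
qed

end

subsection \<open>Connected graphs\<close>

lemma (in wf_digraph) awalk_length_iff_relpow:
  "u \<in> verts G \<Longrightarrow> (\<exists>p. awalk u p v \<and> length p = n) \<longleftrightarrow> (u, v) \<in> arcs_ends G ^^ n"
proof (induction n arbitrary: u)
  case 0
  then show ?case by (auto simp: awalk_Nil_iff)
next
  case (Suc n)
  have "(\<exists>p. awalk u p v \<and> length p = Suc n) \<longleftrightarrow> (\<exists>e p. awalk u (e # p) v \<and> length p = n)"
    by (metis length_Suc_conv)
  also have "\<dots> \<longleftrightarrow> (\<exists>e\<in>arcs G. tail G e = u \<and> (\<exists>p. awalk (head G e) p v \<and> length p = n))"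
    by (auto simp: awalk_Cons_iff)
  also have "\<dots> \<longleftrightarrow> (\<exists>e\<in>arcs G. tail G e = u \<and> (head G e, v) \<in> arcs_ends G ^^ n)"
    using Suc.IH by auto
  also have "\<dots> \<longleftrightarrow> (\<exists>w. (u, w) \<in> arcs_ends G \<and> (w, v) \<in> arcs_ends G ^^ n)"
    by (auto simp: arcs_ends_conv)
  also have "\<dots> \<longleftrightarrow> (u, v) \<in> arcs_ends G ^^ Suc n"
    by (meson relpow_Suc_D2 relpow_Suc_I2)
  finally show ?case .
qed

lemma (in wf_digraph) awalk_imp_short_apath:
  assumes "awalk u p v"
  shows "\<exists>q. apath u q v \<and> length q \<le> length p"
  using assms
proof (induction rule: awalk_to_apath_induct)
  case (path p)
  then show ?case by (auto simp: apath_def)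
next
  case (decomp p q r s)
  then have "p = q @ r @ s" by (auto elim: awalk_cyc_decompE)
  then show ?case using decomp(4) by auto
qed

text \<open>Walks, unlike paths, can be concatenated freely. The minima agree because a walk can be
  shortened to a path.\<close>

lemma (in wf_digraph) graph_dist_eq_Least_relpow:
  assumes "u \<in> verts G"
  shows "graph_dist G u v = (LEAST n. (u, v) \<in> arcs_ends G ^^ n)"
proof -
  define P where "P n \<longleftrightarrow> (\<exists>p. apath u p v \<and> length p = n)" for n
  define Q where "Q n \<longleftrightarrow> (u, v) \<in> arcs_ends G ^^ n" for n
  have PQ: "Q n" if "P n" for n
    using that awalk_length_iff_relpow[OF assms, of v n] awalkI_apath by (auto simp: P_def Q_def)
  have QP: "\<exists>m\<le>n. P m" if "Q n" for n
  proof -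
    obtain p where "awalk u p v" "length p = n"
      using \<open>Q n\<close> awalk_length_iff_relpow[OF assms] unfolding Q_def by blast
    then show ?thesis using awalk_imp_short_apath unfolding P_def by blast
  qed
  have "(LEAST n. P n) = (LEAST n. Q n)"
  proof (cases "\<exists>n. Q n")
    case True
    then have Q: "Q (LEAST n. Q n)" by (rule LeastI_ex)
    then obtain m where m: "m \<le> (LEAST n. Q n)" "P m" using QP by blast
    then have "P (LEAST n. P n)" by (blast intro: LeastI)
    then show ?thesis using m PQ by (meson Least_le le_antisym le_trans)
  next
    case False
    \<comment> \<open>Without any walk the two predicates coincide, hence so do the otherwise
      unspecified values of \<open>LEAST\<close>.\<close>
    then have "P = Q" using PQ by blast
    then show ?thesis by simp
  qed
  then show ?thesis by (simp add: graph_dist_def P_def Q_def)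
qed

locale connected_graph = graph +
  assumes connected: "Digraph_Component.connected G"
begin

lemma relpow_graph_dist:
  assumes "u \<in> verts G" "v \<in> verts G"
  shows "(u, v) \<in> arcs_ends G ^^ graph_dist G u v"
proof -
  have "u \<rightarrow>\<^sup>* v"
    using symmetric_connected_imp_strongly_connected[OF sym_arcs connected] assms
    by (auto simp: strongly_connected_def)
  then have "\<exists>n. (u, v) \<in> arcs_ends G ^^ n"
    using reachable_rtranclI rtrancl_imp_relpow by metis
  then show ?thesis
    unfolding graph_dist_eq_Least_relpow[OF assms(1)] by (rule LeastI_ex)
qed

lemma graph_dist_le: "\<lbrakk>u \<in> verts G; (u, v) \<in> arcs_ends G ^^ n\<rbrakk> \<Longrightarrow> graph_dist G u v \<le> n"
  by (simp add: graph_dist_eq_Least_relpow Least_le)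

lemma graph_dist_self: "u \<in> verts G \<Longrightarrow> graph_dist G u u = 0"
  using graph_dist_le[of u u 0] by simp

lemma graph_dist_eq_0: "\<lbrakk>u \<in> verts G; v \<in> verts G\<rbrakk> \<Longrightarrow> graph_dist G u v = 0 \<longleftrightarrow> u = v"
  using relpow_graph_dist[of u v] graph_dist_self by auto

lemma graph_dist_eq_1:
  assumes "u \<in> verts G" "v \<in> verts G"
  shows "graph_dist G u v = 1 \<longleftrightarrow> u \<rightarrow> v"
proof
  assume "u \<rightarrow> v"
  then have "graph_dist G u v \<le> 1" "u \<noteq> v"
    using graph_dist_le[of u v 1] assms adj_not_same by auto
  then show "graph_dist G u v = 1" using graph_dist_eq_0[OF assms] by linarith
qed (use relpow_graph_dist[OF assms] in auto)

lemma graph_dist_triangle: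
  assumes "a \<in> verts G" "b \<in> verts G" "c \<in> verts G"
  shows "graph_dist G a c \<le> graph_dist G a b + graph_dist G b c"
  using assms relpow_graph_dist[of a b] relpow_graph_dist[of b c]
  by (intro graph_dist_le) (auto simp: relpow_add)

sublocale graph_metric "verts G" "graph_dist G"
proof
  fix a b assume ab: "a \<in> verts G" "b \<in> verts G"
  show "graph_dist G a b = 0 \<longleftrightarrow> a = b" using ab by (rule graph_dist_eq_0)
  show "graph_dist G a b = graph_dist G b a" by (rule graph_dist_commute)
  show "graph_dist G a c \<le> graph_dist G a b + graph_dist G b c" if "c \<in> verts G" for c
    using ab that by (rule graph_dist_triangle)
  assume "a \<noteq> b"
  then obtain m where m: "graph_dist G a b = Suc m"
    using graph_dist_eq_0[OF ab] not0_implies_Suc by blast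
  then obtain c where c: "a \<rightarrow> c" "(c, b) \<in> arcs_ends G ^^ m"
    using relpow_graph_dist[OF ab] by (metis relpow_Suc_D2)
  have cV: "c \<in> verts G" using c adj_in_verts by blast
  have "graph_dist G a c = 1" using c graph_dist_eq_1[OF ab(1) cV] by blast
  moreover have "graph_dist G c b \<le> m" using cV c by (intro graph_dist_le)
  moreover have "graph_dist G a b \<le> graph_dist G a c + graph_dist G c b"
    using ab cV by (intro graph_dist_triangle)
  ultimately show "\<exists>c\<in>verts G. graph_dist G a c = 1 \<and> graph_dist G a b = Suc (graph_dist G c b)"
    using m cV by (intro bexI[of _ c]) auto
qed simp

end

text \<open>An unordered pair comes from two ordered ones, but \<open>{a, a}\<close> from one only;
  the factor 2 is right there because \<open>f\<close> vanishes on the diagonal.\<close>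

lemma sum_on_pair:
  fixes f :: "'a \<Rightarrow> 'a \<Rightarrow> nat"
  assumes fin: "finite R" and sym: "sym R" "\<And>a b. (a, b) \<in> R \<Longrightarrow> f a b = f b a"
    and diag: "\<And>a. (a, a) \<in> R \<Longrightarrow> f a a = 0"
  shows "(\<Sum>(a, b)\<in>R. f a b) = 2 * (\<Sum>e\<in>{{a, b} | a b. (a, b) \<in> R}. on_pair f e)"
proof -
  define g where "g p = (case p of (a, b) \<Rightarrow> {a, b})" for p :: "'a \<times> 'a"
  have img: "g ` R = {{a, b} | a b. (a, b) \<in> R}" by (auto simp: g_def image_iff)
  have "(\<Sum>(a, b)\<in>R. f a b) = (\<Sum>e\<in>g ` R. \<Sum>(a, b)\<in>{p \<in> R. g p = e}. f a b)"
    using fin by (rule sum.image_gen)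
  also have "\<dots> = (\<Sum>e\<in>g ` R. 2 * on_pair f e)"
  proof (rule sum.cong)
    fix e assume "e \<in> g ` R"
    then obtain a b where ab: "(a, b) \<in> R" "e = {a, b}" by (auto simp: g_def)
    then have "(b, a) \<in> R" using sym(1) by (meson symD)
    have g: "g p = e \<longleftrightarrow> p = (a, b) \<or> p = (b, a)" for p
      unfolding ab(2) g_def by (cases p) (simp add: doubleton_eq_iff)
    have "{p \<in> R. g p = e} = {(a, b), (b, a)}"
      unfolding g using ab(1) \<open>(b, a) \<in> R\<close> by blast
    moreover have "on_pair f e = f a b" unfolding ab(2) by (rule on_pair_eq) (rule sym(2)[OF ab(1)])
    moreover have "f b a = f a b" using sym(2)[OF ab(1)] by simp
    moreover have "f a b = 0" if "a = b" using diag ab(1) that by simp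
    ultimately show "(\<Sum>(a, b)\<in>{p \<in> R. g p = e}. f a b) = 2 * on_pair f e"
      by (cases "a = b") simp_all
  qed simp
  finally show ?thesis by (simp add: img sum_distrib_left)
qed

section \<open>Wiener and Szeged index as sums over ordered pairs of vertices\<close>

context connected_graph begin

lemma two_wiener: "2 * wiener_index G = (\<Sum>x\<in>verts G. \<Sum>y\<in>verts G. graph_dist G x y)"
proof -
  have "{{a, b} | a b. a \<in> verts G \<and> b \<in> verts G} = {{a, b} | a b. (a, b) \<in> verts G \<times> verts G}"
    by auto
  then have "2 * wiener_index G = (\<Sum>(x, y)\<in>verts G \<times> verts G. graph_dist G x y)"
    unfolding wiener_index_def
    by (subst sum_on_pair) (auto simp: graph_dist_commute graph_dist_self intro: symI)
  then show ?thesis by (simp add: sum.cartesian_product)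
qed

text \<open>For an arc from \<open>a\<close> to \<open>b\<close>, the product
  \<open>closer G a b * closer G b a\<close> is the number of pairs \<open>x\<close>,
  \<open>y\<close> for which this arc is good. Exchanging the summations collects the good arcs of
  each pair.\<close>

lemma two_szeged: "2 * szeged_index G = (\<Sum>x\<in>verts G. \<Sum>y\<in>verts G. card (good x y))"
proof -
  define V where "V = verts G"
  define D where "D = graph_dist G"
  define R where "R = arcs_ends G"
  have fin: "finite V" "finite R" by (auto simp: V_def R_def arcs_ends_def)
  have RV: "(a, b) \<in> R \<longleftrightarrow> a \<in> V \<and> b \<in> V \<and> D a b = 1" for a b
    using graph_dist_eq_1[of a b] adj_in_verts[of a b] by (auto simp: R_def V_def D_def)
  have closer: "closer G a b = (\<Sum>x\<in>V. of_bool (D x a < D x b))" for a b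
    using fin by (simp add: closer_def V_def D_def sum_of_bool_eq Int_def)
  have good: "card (good x y) = (\<Sum>(a, b)\<in>R. of_bool (D x a < D x b \<and> D y b < D y a))" for x y
  proof -
    have "good x y = {p \<in> R. case p of (a, b) \<Rightarrow> D x a < D x b \<and> D y b < D y a}"
      using RV by (auto simp: good_def V_def D_def)
    then have "card (good x y) = (\<Sum>p\<in>R. of_bool (case p of (a, b) \<Rightarrow> D x a < D x b \<and> D y b < D y a))"
      using fin by (simp add: sum_of_bool_eq Int_def)
    then show ?thesis by (simp add: case_prod_beta)
  qed
  have "2 * szeged_index G = (\<Sum>(a, b)\<in>R. closer G a b * closer G b a)"
    unfolding szeged_index_def R_def
    by (subst sum_on_pair) (use fin sym_arcs adj_not_same in \<open>auto simp: R_def symmetric_def\<close>)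
  also have "\<dots> = (\<Sum>(a, b)\<in>R. \<Sum>x\<in>V. \<Sum>y\<in>V. of_bool (D x a < D x b \<and> D y b < D y a))"
    by (simp add: closer sum_product of_bool_conj)
  also have "\<dots> = (\<Sum>x\<in>V. \<Sum>y\<in>V. \<Sum>(a, b)\<in>R. of_bool (D x a < D x b \<and> D y b < D y a))"
    unfolding case_prod_beta by (subst sum.swap) (intro sum.cong refl sum.swap)
  finally show ?thesis by (simp add: good V_def)
qed

lemma two_eta: "2 * eta G = total (verts G)"
proof -
  have "total (verts G) = (\<Sum>x\<in>verts G. \<Sum>y\<in>verts G. int (card (good x y))) -
      (\<Sum>x\<in>verts G. \<Sum>y\<in>verts G. int (graph_dist G x y))"
    by (simp add: total_def excess_def sum_subtractf)
  also have "\<dots> = int (2 * szeged_index G) - int (2 * wiener_index G)"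
    unfolding two_szeged two_wiener by simp
  finally show ?thesis by (simp add: eta_def)
qed

subsection \<open>Blocks\<close>

lemma subgraph_reachable_adj:
  assumes H: "subgraph H G" and "a \<rightarrow>\<^sup>*\<^bsub>H\<^esub> b"
  shows "(a, b) \<in> (adj (verts H))\<^sup>*"
proof -
  interpret H: wf_digraph H using H by (simp add: subgraph_def)
  show ?thesis
    using assms(2)
  proof (induction rule: H.reachable_induct)
    case (step x y)
    have "x \<rightarrow> y" using step(2) H by (auto simp: arcs_ends_conv subgraph_def compatible_def)
    moreover have "x \<in> verts H" "y \<in> verts H" using step(2) H.adj_in_verts by blast+
    ultimately have "(x, y) \<in> adj (verts H)"
      using adj_in_verts graph_dist_eq_1 by (simp add: adj_def)
    then show ?case by (rule rtrancl_into_rtrancl[OF step.IH])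
  qed simp
qed

lemma no_cut_vertex_imp_nonsep:
  assumes H: "subgraph H G" "graph H" "Digraph_Component.connected H" "\<nexists>v. cut_vertex H v"
  shows "nonsep (verts H)"
proof -
  interpret H: graph H by fact
  have reach: "a \<rightarrow>\<^sup>*\<^bsub>H\<^esub> b" if "a \<in> verts H" "b \<in> verts H" for a b
    using H.symmetric_connected_imp_strongly_connected[OF H.sym_arcs H(3)] that
    by (simp add: strongly_connected_def)
  have "conn (verts H)"
    using reach subgraph_reachable_adj[OF H(1)] by (simp add: conn_def)
  moreover have "conn (verts H - {w})" if w: "w \<in> verts H" for w
    unfolding conn_def
  proof (intro ballI)
    fix a b assume ab: "a \<in> verts H - {w}" "b \<in> verts H - {w}"
    then have "a \<rightarrow>\<^sup>*\<^bsub>H\<^esub> b" using reach by simp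
    then have "a \<rightarrow>\<^sup>*\<^bsub>H.del_vert w\<^esub> b" using H(4) ab w unfolding cut_vertex_def by blast
    moreover have "subgraph (H.del_vert w) G"
      using H.subgraph_del_vert H(1) by (rule subgraph_trans)
    ultimately show "(a, b) \<in> (adj (verts H - {w}))\<^sup>*"
      using subgraph_reachable_adj[of "H.del_vert w" a b] by (simp add: H.verts_del_vert)
  qed
  ultimately show ?thesis by (simp add: nonsep_def)
qed

lemma arcs_ends_induce: "arcs_ends (G \<restriction> S) = arcs_ends G \<inter> S \<times> S"
  by (auto simp: arcs_ends_conv)

lemma adj_reachable_induce:
  assumes "S \<subseteq> verts G" "(a, b) \<in> (adj S)\<^sup>*" "a \<in> S"
  shows "a \<rightarrow>\<^sup>*\<^bsub>G \<restriction> S\<^esub> b"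
proof -
  interpret S: wf_digraph "G \<restriction> S" by (rule wellformed_induce_subgraph)
  show ?thesis
    using assms(2)
  proof (induction rule: rtrancl_induct)
    case base
    show ?case using assms(3) by simp
  next
    case (step y z)
    have "y \<rightarrow>\<^bsub>G \<restriction> S\<^esub> z"
      using step(2) assms(1) graph_dist_eq_1 by (auto simp: adj_def arcs_ends_induce)
    with step.IH show ?case by (rule S.reachable_adj_trans)
  qed
qed

lemma nonsep_imp_no_cut_vertex:
  assumes S: "S \<subseteq> verts G" "S \<noteq> {}" "nonsep S"
  shows "graph (G \<restriction> S)" "Digraph_Component.connected (G \<restriction> S)" "\<nexists>v. cut_vertex (G \<restriction> S) v"
proof -
  have ind: "induced_subgraph (G \<restriction> S) G" using S(1) by (rule induced_induce)
  interpret S: digraph "G \<restriction> S" using ind by (rule digraphI_induced)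
  show graph: "graph (G \<restriction> S)"
    using induced_graph_imp_symmetric[OF sym_arcs ind] by (rule S.graphI)
  interpret S: graph "G \<restriction> S" by (rule graph)
  have "strongly_connected (G \<restriction> S)"
    using S adj_reachable_induce[OF S(1)] by (auto simp: nonsep_def conn_def strongly_connected_def)
  then show "Digraph_Component.connected (G \<restriction> S)"
    using S.sym_arcs
    by (simp add: Digraph_Component.connected_def strongly_connected_def S.reachable_mk_symmetric_eq)
  show "\<nexists>v. cut_vertex (G \<restriction> S) v"
  proof
    assume "\<exists>v. cut_vertex (G \<restriction> S) v"
    then obtain v a b where v: "v \<in> S" "a \<in> S - {v}" "b \<in> S - {v}"
      "\<not> a \<rightarrow>\<^sup>*\<^bsub>pre_digraph.del_vert (G \<restriction> S) v\<^esub> b"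
      unfolding cut_vertex_def by auto
    have "(a, b) \<in> (adj (S - {v}))\<^sup>*" using S(3) v by (auto simp: nonsep_def conn_def)
    then have "a \<rightarrow>\<^sup>*\<^bsub>G \<restriction> (S - {v})\<^esub> b"
      using S(1) v(2) by (intro adj_reachable_induce) auto
    moreover have "G \<restriction> (S - {v}) = pre_digraph.del_vert (G \<restriction> S) v"
      by (auto simp: induce_subgraph_def pre_digraph.del_vert_def)
    ultimately show False using v(4) by simp
  qed
qed

text \<open>The subgraph induced on a nonseparable set containing \<open>verts B\<close> is
  connected without cut-vertices and contains \<open>B\<close>, so by maximality it is
  \<open>B\<close>. Applied to \<open>verts B\<close> itself, this shows that a block is
  induced.\<close>

lemma block_facts:
  assumes "block G B"
  shows "verts B \<subseteq> verts G" "nonsep (verts B)" "B = G \<restriction> verts B"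
    and "\<lbrakk>nonsep S; verts B \<subseteq> S; S \<subseteq> verts G\<rbrakk> \<Longrightarrow> S = verts B"
proof -
  have B: "subgraph B G" "graph B" "Digraph_Component.connected B" "\<nexists>v. cut_vertex B v"
    and max: "\<And>H. \<lbrakk>subgraph B H; subgraph H G; graph H; Digraph_Component.connected H; \<nexists>v. cut_vertex H v\<rbrakk> \<Longrightarrow> H = B"
    using assms unfolding block_def max_subgraph_def by blast+
  show sub: "verts B \<subseteq> verts G" using B(1) by (simp add: subgraph_def)
  show nonsep: "nonsep (verts B)" using B by (rule no_cut_vertex_imp_nonsep)
  have ne: "verts B \<noteq> {}" using B(3) connected_conv by blast
  have induce: "G \<restriction> S = B" if S: "nonsep S" "verts B \<subseteq> S" "S \<subseteq> verts G" for S
  proof (rule max)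
    show "subgraph (G \<restriction> S) G" using S(3) by (rule subgraph_induce_subgraphI)
    show "subgraph B (G \<restriction> S)"
      using B(1) S wellformed_induce_subgraph[of S]
      by (auto simp: subgraph_def compatible_def wf_digraph.wellformed subset_iff)
    have "S \<noteq> {}" using ne S by blast
    then show "graph (G \<restriction> S)" "Digraph_Component.connected (G \<restriction> S)" "\<nexists>v. cut_vertex (G \<restriction> S) v"
      using nonsep_imp_no_cut_vertex S by blast+
  qed
  show "B = G \<restriction> verts B" using induce[OF nonsep order_refl sub] by simp
  show "S = verts B" if "nonsep S" "verts B \<subseteq> S" "S \<subseteq> verts G"
    using arg_cong[OF induce[OF that], of verts] by simp
qed

text \<open>Since a block is induced, non-completeness gives two vertices that are not adjacent in
  the whole graph either. By isometry \<open>total_excess_ge\<close> applies inside the block with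
  the distances of \<open>G\<close>.\<close>

lemma noncomplete_block_total:
  assumes B: "block G B" "\<not> complete_graph B"
  shows "4 * int (card (verts B)) - 12 \<le> total (verts B)"
proof -
  note b = block_facts[OF B(1)]
  have metric: "graph_metric (verts B) (graph_dist G)"
    using b(1,2,4) by (rule maximal_nonsep_metric)
  interpret B: graph_metric "verts B" "graph_dist G" by (rule metric)
  have "\<exists>x\<in>verts B. \<exists>y\<in>verts B. 2 \<le> graph_dist G x y"
  proof (rule ccontr)
    assume *: "\<not> ?thesis"
    have "x \<rightarrow> y \<longleftrightarrow> x \<noteq> y" if "x \<in> verts B" "y \<in> verts B" for x y
    proof -
      have "x \<in> verts G" "y \<in> verts G" "graph_dist G x y < 2" using that b(1) * by (auto simp: not_le)
      then show ?thesis using graph_dist_eq_1[of x y] graph_dist_eq_0[of x y] by linarith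
    qed
    then have "arcs_ends (G \<restriction> verts B) = {(u, v). (u, v) \<in> verts B \<times> verts B \<and> u \<noteq> v}"
      by (auto simp: arcs_ends_induce)
    moreover have "graph B" using B(1) unfolding block_def max_subgraph_def by blast
    ultimately show False using B(2) b(3) by (simp add: complete_graph_def complete_digraph_def)
  qed
  then obtain x y where "x \<in> verts B" "y \<in> verts B" "2 \<le> graph_dist G x y" by blast
  then have "4 * int (card (verts B)) - 12 \<le> B.total (verts B)"
    using b(2) by (intro B.total_excess_ge)
  also have "\<dots> \<le> total (verts B)"
    unfolding B.total_def total_def using excess_subset[OF metric b(1)] by (intro sum_mono)
  finally show ?thesis .
qed

lemma block_eqI:
  assumes "block G A" "block G B" "x \<in> verts A \<inter> verts B" "y \<in> verts A \<inter> verts B" "x \<noteq> y"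
  shows "verts A = verts B"
proof -
  note a = block_facts[OF assms(1)] and b = block_facts[OF assms(2)]
  have sub: "verts A \<union> verts B \<subseteq> verts G" using a(1) b(1) by blast
  have "nonsep (verts A \<union> verts B)"
    using sub a(2) b(2) assms(3-5) by (rule nonsep_Un)
  then have "verts A \<union> verts B = verts A" "verts A \<union> verts B = verts B"
    using a(4) b(4) sub by blast+
  then show ?thesis by blast
qed

lemma eta_ge_sum_blocks:
  "(\<Sum>B \<in> {B. block G B \<and> \<not> complete_graph B}. 2 * int (card (verts B)) - 6) \<le> eta G"
proof -
  define F where "F = {B. block G B \<and> \<not> complete_graph B}"
  \<comment> \<open>Induced subgraphs are determined by their vertices, so the sum over blocks can
    run over vertex sets.\<close>
  have inj: "inj_on verts F"
    using block_facts(3) by (intro inj_onI) (metis F_def mem_Collect_eq)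
  have "finite (verts ` F)"
    by (rule finite_subset[of _ "Pow (verts G)"]) (use block_facts(1) in \<open>auto simp: F_def\<close>)
  have "2 * (\<Sum>B\<in>F. 2 * int (card (verts B)) - 6) = (\<Sum>B\<in>F. 4 * int (card (verts B)) - 12)"
    unfolding sum_distrib_left by (intro sum.cong) auto
  also have "\<dots> \<le> (\<Sum>B\<in>F. total (verts B))"
    using noncomplete_block_total by (intro sum_mono) (simp add: F_def)
  also have "\<dots> = (\<Sum>S\<in>verts ` F. total S)"
    using inj by (simp add: sum.reindex)
  also have "\<dots> \<le> total (verts G)"
  proof (rule sum_total_le)
    show "S \<subseteq> verts G" if "S \<in> verts ` F" for S
      using that block_facts(1) by (auto simp: F_def)
    show "S = T" if "S \<in> verts ` F" "T \<in> verts ` F" "x \<in> S \<inter> T" "y \<in> S \<inter> T" "x \<noteq> y" for S T x y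
      using that block_eqI unfolding F_def by blast
  qed fact
  also have "\<dots> = 2 * eta G" by (simp add: two_eta)
  finally show ?thesis by (simp add: F_def)
qed

end

theorem corollary3:
  fixes G :: "('a, 'b) pre_digraph"
  assumes "graph G" and "Digraph_Component.connected G"
  shows "eta G \<ge> (\<Sum>B \<in> {B. block G B \<and> \<not> complete_graph B}. 2 * int (card (verts B)) - 6)"
proof -
  interpret connected_graph G
    using assms by (simp add: connected_graph_def connected_graph_axioms_def)
  show ?thesis by (rule eta_ge_sum_blocks)
qed

end
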